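(* Let $m,n,k$ be non-negative integers with $k\le n$ and let $b_1<\dots<b_k$ be positive integers with $b_k\le m+k$. Then $\sum_G u^{\operatorname{inv}(G)}v^{\operatorname{inv}'(G)}$, summed over all $(m,n,k)$-Gog trapezoids $G$ with bottom row $(b_1,\dots,b_k)$, equals the constant term in $x_1,\dots,x_n$ of $$\prod_{i=1}^k(1+x_i)^{b_i}x_i^{-n+1}\prod_{i=k+1}^n(1+x_i)^{m+i+1}(1+ux_i)^{k-i}x_i^{-n+i-k}\prod_{1\le i<j\le n}(x_i-x_j)\bigl(1+(1-v)x_i+u(x_j+x_ix_j)\bigr).$$
   Context: For non-negative integers $m,n,k$ with $k\le n$, an $(m,n,k)$-Gog trapezoid is an array $(m_{i,j})$ of positive integers indexed by $1\le i\le n$, $1\le j\le\min(i,k)$ (the $k$ leftmost NE-diagonals of a triangular array with $n$ rows), such that $m_{i+1,j}\le m_{i,j}\le m_{i+1,j+1}$ whenever the entries exist, rows are strictly increasing, and $m_{i,j}\le m+n-i+j$. Bottom row: $(m_{n,1},\dots,m_{n,k})$. $\operatorname{inv}(G)=\#\{(i,j):m_{i,j}=m_{i+1,j+1}\text{ with both entries in }G\}$, $\operatorname{inv}'(G)=\#\{(i,j):m_{i,j}=m_{i+1,j}\text{ with both entries in }G\}$. $u,v$ are indeterminates; $(1+ux_i)^{k-i}$ is expanded as a power series in $x_i$. *)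

theory Defs
  imports "HOL-Library.Poly_Mapping" "HOL-Computational_Algebra.Polynomial"
begin

section \<open>Formal Laurent series in several variables\<close>

text \<open>
  A monomial is an exponent vector of type \<open>nat \<Rightarrow>\<^sub>0 int\<close>.  A formal Laurent series involves only
  finitely many variables, and its exponents are bounded below; the number \<open>N\<close> in the box
  below serves as a bound for both.  The supports of all products are then locally finite, so that
  the series form a commutative ring.
\<close>

definition expbox :: "nat \<Rightarrow> (nat \<Rightarrow>\<^sub>0 int) set" where
  "expbox N = {\<alpha>. \<forall>i. (i < N \<longrightarrow> - int N \<le> Poly_Mapping.lookup \<alpha> i) \<and> (N \<le> i \<longrightarrow> Poly_Mapping.lookup \<alpha> i = 0)}"

typedef (overloaded) ('a::zero) mfls =
  "{f :: (nat \<Rightarrow>\<^sub>0 int) \<Rightarrow> 'a. \<exists>N. \<forall>\<alpha>. f \<alpha> \<noteq> 0 \<longrightarrow> \<alpha> \<in> expbox N}"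
  morphisms mfls_coeff Abs_mfls
  by (rule exI[of _ "\<lambda>_. 0"]) simp

setup_lifting type_definition_mfls

lemma mfls_eqI: "(\<And>\<alpha>. mfls_coeff f \<alpha> = mfls_coeff g \<alpha>) \<Longrightarrow> f = g"
  by (simp add: mfls_coeff_inject[symmetric] fun_eq_iff)

lemma expbox_mono: "N \<le> M \<Longrightarrow> \<alpha> \<in> expbox N \<Longrightarrow> \<alpha> \<in> expbox M"
proof -
  assume le: "N \<le> M" and a: "\<alpha> \<in> expbox N"
  have "- int M \<le> Poly_Mapping.lookup \<alpha> i" "M \<le> i \<Longrightarrow> Poly_Mapping.lookup \<alpha> i = 0" for i
  proof -
    have *: "i < N \<longrightarrow> - int N \<le> Poly_Mapping.lookup \<alpha> i" "N \<le> i \<longrightarrow> Poly_Mapping.lookup \<alpha> i = 0"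
      using a by (simp_all add: expbox_def)
    then show "- int M \<le> Poly_Mapping.lookup \<alpha> i"
      using le by (cases "i < N") auto
    show "M \<le> i \<Longrightarrow> Poly_Mapping.lookup \<alpha> i = 0"
      using * le by simp
  qed
  then show ?thesis by (simp add: expbox_def)
qed

lemma expbox_add: "\<alpha> \<in> expbox N \<Longrightarrow> \<beta> \<in> expbox M \<Longrightarrow> \<alpha> + \<beta> \<in> expbox (N + M)"
proof -
  assume a: "\<alpha> \<in> expbox N" and b: "\<beta> \<in> expbox M"
  have "- int N \<le> Poly_Mapping.lookup \<alpha> i" "- int M \<le> Poly_Mapping.lookup \<beta> i" for i
  proof -
    show "- int N \<le> Poly_Mapping.lookup \<alpha> i"
      using a by (cases "i < N") (simp_all add: expbox_def)
    show "- int M \<le> Poly_Mapping.lookup \<beta> i"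
      using b by (cases "i < M") (simp_all add: expbox_def)
  qed
  then have "- int (N + M) \<le> Poly_Mapping.lookup \<alpha> i + Poly_Mapping.lookup \<beta> i" for i
    using add_mono[of "- int N" "Poly_Mapping.lookup \<alpha> i" "- int M" "Poly_Mapping.lookup \<beta> i"] by simp
  then show ?thesis
    using a b by (simp add: expbox_def lookup_add)
qed

lemma zero_in_expbox: "0 \<in> expbox N"
  by (simp add: expbox_def)

lemma ex_expbox: "\<exists>N. \<alpha> \<in> expbox N"
proof -
  define M where "M = Max (insert 0 (Poly_Mapping.keys \<alpha> \<union> (\<lambda>i. nat (- Poly_Mapping.lookup \<alpha> i)) ` Poly_Mapping.keys \<alpha>))"
  have M: "i \<le> M" "nat (- Poly_Mapping.lookup \<alpha> i) \<le> M" if "i \<in> Poly_Mapping.keys \<alpha>" for i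
    unfolding M_def using that by (auto intro!: Max_ge)
  have "\<alpha> \<in> expbox (Suc M)"
    unfolding expbox_def
  proof (clarify, intro conjI impI)
    fix i
    show "- int (Suc M) \<le> Poly_Mapping.lookup \<alpha> i"
      using M(2)[of i] by (cases "i \<in> Poly_Mapping.keys \<alpha>") (auto simp: in_keys_iff)
    assume "Suc M \<le> i"
    then show "Poly_Mapping.lookup \<alpha> i = 0"
      using M(1)[of i] by (cases "i \<in> Poly_Mapping.keys \<alpha>") (auto simp: in_keys_iff)
  qed
  then show ?thesis ..
qed

lemma finite_expbox_pair: "finite {\<beta>. \<beta> \<in> expbox N \<and> \<alpha> - \<beta> \<in> expbox M}"
proof -
  let ?B = "\<Union>i<N. {- int N .. Poly_Mapping.lookup \<alpha> i + int M}"
  let ?F = "{g. \<forall>i. (i \<in> {..<N} \<longrightarrow> g i \<in> ?B) \<and> (i \<notin> {..<N} \<longrightarrow> g i = (0::int))}"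
  have "finite ?F"
    by (rule finite_set_of_finite_funs) auto
  moreover have "Poly_Mapping.lookup ` {\<beta>. \<beta> \<in> expbox N \<and> \<alpha> - \<beta> \<in> expbox M} \<subseteq> ?F"
  proof clarify
    fix \<beta> i assume b: "\<beta> \<in> expbox N" and ab: "\<alpha> - \<beta> \<in> expbox M"
    have "- int M \<le> Poly_Mapping.lookup \<alpha> i - Poly_Mapping.lookup \<beta> i"
      using ab by (cases "i < M") (simp_all add: expbox_def lookup_minus)
    then have le: "Poly_Mapping.lookup \<beta> i \<le> Poly_Mapping.lookup \<alpha> i + int M"
      by (simp add: algebra_simps)
    show "(i \<in> {..<N} \<longrightarrow> Poly_Mapping.lookup \<beta> i \<in> ?B) \<and> (i \<notin> {..<N} \<longrightarrow> Poly_Mapping.lookup \<beta> i = 0)"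
    proof (intro conjI impI)
      assume i: "i \<in> {..<N}"
      then have "Poly_Mapping.lookup \<beta> i \<in> {- int N .. Poly_Mapping.lookup \<alpha> i + int M}"
        using b le by (simp add: expbox_def)
      with i show "Poly_Mapping.lookup \<beta> i \<in> ?B" by blast
    next
      assume "i \<notin> {..<N}"
      then show "Poly_Mapping.lookup \<beta> i = 0"
        using b by (simp add: expbox_def)
    qed
  qed
  ultimately have "finite (Poly_Mapping.lookup ` {\<beta>. \<beta> \<in> expbox N \<and> \<alpha> - \<beta> \<in> expbox M})"
    by (rule finite_subset[rotated])
  then show ?thesis
    by (rule finite_imageD) (rule inj_onI, simp only: poly_mapping_eq_iff)
qed

lemma mfls_bound: "\<exists>N. \<forall>\<alpha>. mfls_coeff f \<alpha> \<noteq> 0 \<longrightarrow> \<alpha> \<in> expbox N"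
  using mfls_coeff[of f] by simp

lemma mfls_bound2:
  "\<exists>N. (\<forall>\<alpha>. mfls_coeff f \<alpha> \<noteq> 0 \<longrightarrow> \<alpha> \<in> expbox N) \<and> (\<forall>\<alpha>. mfls_coeff g \<alpha> \<noteq> 0 \<longrightarrow> \<alpha> \<in> expbox N)"
proof -
  obtain N M where "\<forall>\<alpha>. mfls_coeff f \<alpha> \<noteq> 0 \<longrightarrow> \<alpha> \<in> expbox N" "\<forall>\<alpha>. mfls_coeff g \<alpha> \<noteq> 0 \<longrightarrow> \<alpha> \<in> expbox M"
    using mfls_bound[of f] mfls_bound[of g] by blast
  then show ?thesis
    using expbox_mono[of N "max N M"] expbox_mono[of M "max N M"]
    by (intro exI[of _ "max N M"]) simp
qed

instantiation mfls :: (zero) zero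
begin
lift_definition zero_mfls :: "'a mfls" is "\<lambda>_. 0" by simp
instance ..
end

definition mmonom :: "(nat \<Rightarrow>\<^sub>0 int) \<Rightarrow> 'a::zero \<Rightarrow> 'a mfls" where
  "mmonom \<alpha> c = Abs_mfls (\<lambda>\<beta>. if \<beta> = \<alpha> then c else 0)"

lemma mfls_coeff_mmonom: "mfls_coeff (mmonom \<alpha> c) \<beta> = (if \<beta> = \<alpha> then c else 0)"
  unfolding mmonom_def by (subst Abs_mfls_inverse) (use ex_expbox[of \<alpha>] in auto)

instantiation mfls :: (comm_ring_1) comm_ring_1
begin

definition one_mfls :: "'a mfls" where "one_mfls = mmonom 0 1"

lift_definition plus_mfls :: "'a mfls \<Rightarrow> 'a mfls \<Rightarrow> 'a mfls" is "\<lambda>f g \<alpha>. f \<alpha> + g \<alpha>"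
proof -
  fix f g :: "(nat \<Rightarrow>\<^sub>0 int) \<Rightarrow> 'a"
  assume "\<exists>N. \<forall>\<alpha>. f \<alpha> \<noteq> 0 \<longrightarrow> \<alpha> \<in> expbox N" "\<exists>N. \<forall>\<alpha>. g \<alpha> \<noteq> 0 \<longrightarrow> \<alpha> \<in> expbox N"
  then obtain N M where "\<forall>\<alpha>. f \<alpha> \<noteq> 0 \<longrightarrow> \<alpha> \<in> expbox N" "\<forall>\<alpha>. g \<alpha> \<noteq> 0 \<longrightarrow> \<alpha> \<in> expbox M"
    by blast
  then have "f \<alpha> + g \<alpha> \<noteq> 0 \<longrightarrow> \<alpha> \<in> expbox (max N M)" for \<alpha>
    using expbox_mono[of N "max N M" \<alpha>] expbox_mono[of M "max N M" \<alpha>]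
    by (cases "f \<alpha> = 0") auto
  then have "\<forall>\<alpha>. f \<alpha> + g \<alpha> \<noteq> 0 \<longrightarrow> \<alpha> \<in> expbox (max N M)" ..
  then show "\<exists>N. \<forall>\<alpha>. f \<alpha> + g \<alpha> \<noteq> 0 \<longrightarrow> \<alpha> \<in> expbox N" ..
qed

lift_definition uminus_mfls :: "'a mfls \<Rightarrow> 'a mfls" is "\<lambda>f \<alpha>. - f \<alpha>" by simp

definition minus_mfls :: "'a mfls \<Rightarrow> 'a mfls \<Rightarrow> 'a mfls" where "minus_mfls f g = f + - g"

lift_definition times_mfls :: "'a mfls \<Rightarrow> 'a mfls \<Rightarrow> 'a mfls"
  is "\<lambda>f g \<alpha>. \<Sum>\<beta> | f \<beta> \<noteq> 0 \<and> g (\<alpha> - \<beta>) \<noteq> 0. f \<beta> * g (\<alpha> - \<beta>)"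
proof -
  fix f g :: "(nat \<Rightarrow>\<^sub>0 int) \<Rightarrow> 'a"
  assume "\<exists>N. \<forall>\<alpha>. f \<alpha> \<noteq> 0 \<longrightarrow> \<alpha> \<in> expbox N" "\<exists>N. \<forall>\<alpha>. g \<alpha> \<noteq> 0 \<longrightarrow> \<alpha> \<in> expbox N"
  then obtain N M where *: "\<forall>\<alpha>. f \<alpha> \<noteq> 0 \<longrightarrow> \<alpha> \<in> expbox N" "\<forall>\<alpha>. g \<alpha> \<noteq> 0 \<longrightarrow> \<alpha> \<in> expbox M"
    by blast
  have "\<alpha> \<in> expbox (N + M)" if "(\<Sum>\<beta> | f \<beta> \<noteq> 0 \<and> g (\<alpha> - \<beta>) \<noteq> 0. f \<beta> * g (\<alpha> - \<beta>)) \<noteq> 0" for \<alpha>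
  proof -
    from that have "{\<beta>. f \<beta> \<noteq> 0 \<and> g (\<alpha> - \<beta>) \<noteq> 0} \<noteq> {}"
      by (rule contrapos_nn) (simp only: sum.empty)
    then obtain \<beta> where "f \<beta> \<noteq> 0" "g (\<alpha> - \<beta>) \<noteq> 0" by blast
    with * have "\<beta> + (\<alpha> - \<beta>) \<in> expbox (N + M)"
      by (blast intro: expbox_add)
    then show ?thesis by simp
  qed
  then show "\<exists>N. \<forall>\<alpha>. (\<Sum>\<beta> | f \<beta> \<noteq> 0 \<and> g (\<alpha> - \<beta>) \<noteq> 0. f \<beta> * g (\<alpha> - \<beta>)) \<noteq> 0 \<longrightarrow> \<alpha> \<in> expbox N"
    by blast
qed

lemma mfls_coeff_mult_expbox:
  fixes f g :: "'a mfls"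
  assumes "\<forall>\<alpha>. mfls_coeff f \<alpha> \<noteq> 0 \<longrightarrow> \<alpha> \<in> expbox N" "\<forall>\<alpha>. mfls_coeff g \<alpha> \<noteq> 0 \<longrightarrow> \<alpha> \<in> expbox M"
  shows "mfls_coeff (f * g) \<alpha>
      = (\<Sum>\<beta> | \<beta> \<in> expbox N \<and> \<alpha> - \<beta> \<in> expbox M. mfls_coeff f \<beta> * mfls_coeff g (\<alpha> - \<beta>))"
  unfolding times_mfls.rep_eq
  by (rule sum.mono_neutral_left) (use assms in \<open>auto simp: finite_expbox_pair\<close>)

lemma mfls_coeff_mult_bound:
  fixes f g :: "'a mfls"
  assumes "\<forall>\<alpha>. mfls_coeff f \<alpha> \<noteq> 0 \<longrightarrow> \<alpha> \<in> expbox N" "\<forall>\<alpha>. mfls_coeff g \<alpha> \<noteq> 0 \<longrightarrow> \<alpha> \<in> expbox M"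
  shows "\<forall>\<alpha>. mfls_coeff (f * g) \<alpha> \<noteq> 0 \<longrightarrow> \<alpha> \<in> expbox (N + M)"
proof (intro allI impI)
  fix \<alpha> assume "mfls_coeff (f * g) \<alpha> \<noteq> 0"
  then have "{\<beta>. \<beta> \<in> expbox N \<and> \<alpha> - \<beta> \<in> expbox M} \<noteq> {}"
    unfolding mfls_coeff_mult_expbox[OF assms]
    by (rule contrapos_nn) (simp only: sum.empty)
  then obtain \<beta> where "\<beta> \<in> expbox N" "\<alpha> - \<beta> \<in> expbox M" by blast
  then have "\<beta> + (\<alpha> - \<beta>) \<in> expbox (N + M)"
    by (rule expbox_add)
  then show "\<alpha> \<in> expbox (N + M)" by simp
qed

lemma mfls_coeff_mmonom_mult:
  fixes f :: "'a mfls"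
  shows "mfls_coeff (mmonom \<alpha> c * f) \<gamma> = c * mfls_coeff f (\<gamma> - \<alpha>)"
proof -
  have "mfls_coeff (mmonom \<alpha> c * f) \<gamma>
      = (\<Sum>\<beta> | \<beta> = \<alpha> \<and> c \<noteq> 0 \<and> mfls_coeff f (\<gamma> - \<beta>) \<noteq> 0. c * mfls_coeff f (\<gamma> - \<beta>))"
    unfolding times_mfls.rep_eq mfls_coeff_mmonom by (rule sum.cong) auto
  also have "\<dots> = (\<Sum>\<beta>\<in>{\<alpha>}. c * mfls_coeff f (\<gamma> - \<beta>))"
    by (rule sum.mono_neutral_left) auto
  finally show ?thesis by simp
qed

instance
proof
  fix a b c :: "'a mfls"
  show "a + b + c = a + (b + c)" "a + b = b + a" "0 + a = a" "- a + a = 0"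
    by (rule mfls_eqI, simp add: plus_mfls.rep_eq uminus_mfls.rep_eq zero_mfls.rep_eq add.assoc add.commute)+
  show "a - b = a + - b" by (rule minus_mfls_def)
  show "a * b = b * a"
  proof (rule mfls_eqI)
    fix \<alpha>
    show "mfls_coeff (a * b) \<alpha> = mfls_coeff (b * a) \<alpha>"
      unfolding times_mfls.rep_eq
      by (rule sum.reindex_bij_witness[where i = "\<lambda>\<beta>. \<alpha> - \<beta>" and j = "\<lambda>\<beta>. \<alpha> - \<beta>"])
        (auto simp: mult.commute)
  qed
  show "1 * a = a"
    by (rule mfls_eqI) (simp add: one_mfls_def mfls_coeff_mmonom_mult)
  show "(0 :: 'a mfls) \<noteq> 1"
  proof
    assume "(0 :: 'a mfls) = 1"
    then have "mfls_coeff (0 :: 'a mfls) 0 = mfls_coeff 1 0" by simp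
    then show False by (simp add: one_mfls_def mfls_coeff_mmonom zero_mfls.rep_eq)
  qed
  show "(a + b) * c = a * c + b * c"
  proof (rule mfls_eqI)
    fix \<alpha>
    obtain N where N: "\<forall>\<alpha>. mfls_coeff a \<alpha> \<noteq> 0 \<longrightarrow> \<alpha> \<in> expbox N" "\<forall>\<alpha>. mfls_coeff b \<alpha> \<noteq> 0 \<longrightarrow> \<alpha> \<in> expbox N"
      using mfls_bound2 by blast
    obtain M where M: "\<forall>\<alpha>. mfls_coeff c \<alpha> \<noteq> 0 \<longrightarrow> \<alpha> \<in> expbox M"
      using mfls_bound by blast
    have "\<forall>\<alpha>. mfls_coeff (a + b) \<alpha> \<noteq> 0 \<longrightarrow> \<alpha> \<in> expbox N"
    proof (intro allI impI)
      fix \<beta> assume "mfls_coeff (a + b) \<beta> \<noteq> 0"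
      then have "mfls_coeff a \<beta> \<noteq> 0 \<or> mfls_coeff b \<beta> \<noteq> 0"
        by (auto simp: plus_mfls.rep_eq)
      then show "\<beta> \<in> expbox N" using N by blast
    qed
    note ab = this
    show "mfls_coeff ((a + b) * c) \<alpha> = mfls_coeff (a * c + b * c) \<alpha>"
      unfolding plus_mfls.rep_eq mfls_coeff_mult_expbox[OF ab M]
        mfls_coeff_mult_expbox[OF N(1) M] mfls_coeff_mult_expbox[OF N(2) M]
      by (simp only: distrib_right sum.distrib)
  qed
  show "a * b * c = a * (b * c)"
  proof (rule mfls_eqI)
    fix \<alpha>
    obtain N where N: "\<forall>\<alpha>. mfls_coeff a \<alpha> \<noteq> 0 \<longrightarrow> \<alpha> \<in> expbox N" using mfls_bound by blast
    obtain M where M: "\<forall>\<alpha>. mfls_coeff b \<alpha> \<noteq> 0 \<longrightarrow> \<alpha> \<in> expbox M" using mfls_bound by blast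
    obtain K where K: "\<forall>\<alpha>. mfls_coeff c \<alpha> \<noteq> 0 \<longrightarrow> \<alpha> \<in> expbox K" using mfls_bound by blast
    let ?t = "\<lambda>\<beta> \<gamma>. mfls_coeff a \<beta> * (mfls_coeff b \<gamma> * mfls_coeff c (\<alpha> - \<beta> - \<gamma>))"
    have "mfls_coeff (a * b * c) \<alpha> =
        (\<Sum>\<gamma> | \<gamma> \<in> expbox (N + M) \<and> \<alpha> - \<gamma> \<in> expbox K. \<Sum>\<beta> | \<beta> \<in> expbox N \<and> \<gamma> - \<beta> \<in> expbox M.
           mfls_coeff a \<beta> * mfls_coeff b (\<gamma> - \<beta>) * mfls_coeff c (\<alpha> - \<gamma>))"
      unfolding mfls_coeff_mult_expbox[OF mfls_coeff_mult_bound[OF N M] K]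
        mfls_coeff_mult_expbox[OF N M] sum_distrib_right ..
    also have "\<dots> = (\<Sum>(\<gamma>, \<beta>) \<in> Sigma {\<gamma>. \<gamma> \<in> expbox (N + M) \<and> \<alpha> - \<gamma> \<in> expbox K}
           (\<lambda>\<gamma>. {\<beta>. \<beta> \<in> expbox N \<and> \<gamma> - \<beta> \<in> expbox M}).
           mfls_coeff a \<beta> * mfls_coeff b (\<gamma> - \<beta>) * mfls_coeff c (\<alpha> - \<gamma>))"
      by (rule sum.Sigma) (simp_all add: finite_expbox_pair)
    also have "\<dots> = (\<Sum>(\<beta>, \<gamma>) \<in> Sigma {\<beta>. \<beta> \<in> expbox N \<and> \<alpha> - \<beta> \<in> expbox (M + K)}
           (\<lambda>\<beta>. {\<gamma>. \<gamma> \<in> expbox M \<and> \<alpha> - \<beta> - \<gamma> \<in> expbox K}). ?t \<beta> \<gamma>)"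
    proof (rule sum.reindex_bij_witness[where j = "\<lambda>(\<gamma>, \<beta>). (\<beta>, \<gamma> - \<beta>)"
            and i = "\<lambda>(\<beta>, \<gamma>). (\<beta> + \<gamma>, \<beta>)"], goal_cases)
      case (2 x)
      then obtain \<gamma> \<beta> where x: "x = (\<gamma>, \<beta>)" "\<alpha> - \<gamma> \<in> expbox K" "\<beta> \<in> expbox N" "\<gamma> - \<beta> \<in> expbox M"
        by auto
      from expbox_add[OF x(4,2)] have "\<alpha> - \<beta> \<in> expbox (M + K)" by simp
      with x show ?case by simp
    next
      case (4 x)
      then obtain \<beta> \<gamma> where x: "x = (\<beta>, \<gamma>)" "\<beta> \<in> expbox N" "\<gamma> \<in> expbox M" "\<alpha> - \<beta> - \<gamma> \<in> expbox K"
        by auto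
      then show ?case using expbox_add[OF x(2,3)] by (simp add: diff_diff_eq)
    qed (auto simp: mult.assoc)
    also have "\<dots> = mfls_coeff (a * (b * c)) \<alpha>"
      unfolding mfls_coeff_mult_expbox[OF N mfls_coeff_mult_bound[OF M K]]
        mfls_coeff_mult_expbox[OF M K] sum_distrib_left
      by (rule sum.Sigma[symmetric]) (simp_all add: finite_expbox_pair)
    finally show "mfls_coeff (a * b * c) \<alpha> = mfls_coeff (a * (b * c)) \<alpha>" .
  qed
qed

end

text \<open>
  The inverse of a unit of the ring; as usual, the inverse of a non-unit is \<open>0\<close>.
\<close>

instantiation mfls :: (comm_ring_1) inverse
begin
definition inverse_mfls :: "'a mfls \<Rightarrow> 'a mfls" where
  "inverse_mfls f = (if \<exists>g. f * g = 1 then THE g. f * g = 1 else 0)"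
definition divide_mfls :: "'a mfls \<Rightarrow> 'a mfls \<Rightarrow> 'a mfls" where
  "divide_mfls f g = f * inverse g"
instance ..
end

lemma mfls_inverse_unique:
  fixes f g :: "'a::comm_ring_1 mfls"
  assumes "f * g = 1"
  shows "inverse f = g"
proof -
  have "h = g" if "f * h = 1" for h
  proof -
    have "h = f * g * h" using assms by simp
    also have "\<dots> = f * h * g" by (simp only: mult.assoc mult.commute[of g h])
    finally show ?thesis using that by simp
  qed
  then have "(THE g. f * g = 1) = g"
    using assms by (intro the_equality)
  moreover have "\<exists>g. f * g = 1" using assms ..
  ultimately show ?thesis
    unfolding inverse_mfls_def by (simp only: if_True)
qed

lemma mmonom_mult_mmonom:
  fixes c d :: "'a::comm_ring_1"
  shows "mmonom \<alpha> c * mmonom \<beta> d = mmonom (\<alpha> + \<beta>) (c * d)"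
proof (rule mfls_eqI)
  fix \<gamma>
  have "\<gamma> - \<alpha> = \<beta> \<longleftrightarrow> \<gamma> = \<alpha> + \<beta>"
    by (metis add_diff_cancel_left' add_diff_cancel_right' add.commute diff_add_cancel)
  then show "mfls_coeff (mmonom \<alpha> c * mmonom \<beta> d) \<gamma> = mfls_coeff (mmonom (\<alpha> + \<beta>) (c * d)) \<gamma>"
    unfolding mfls_coeff_mmonom_mult mfls_coeff_mmonom by (cases "\<gamma> = \<alpha> + \<beta>") simp_all
qed

definition mconst :: "'a::zero \<Rightarrow> 'a mfls" where "mconst c = mmonom 0 c"

definition mvar :: "nat \<Rightarrow> 'a::comm_ring_1 mfls" where "mvar i = mmonom (Poly_Mapping.single i 1) 1"

definition constant_term :: "'a::zero mfls \<Rightarrow> 'a" where "constant_term f = mfls_coeff f 0"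

lemma inverse_mvar: "inverse (mvar i :: 'a::comm_ring_1 mfls) = mmonom (Poly_Mapping.single i (- 1)) 1"
proof (rule mfls_inverse_unique)
  have "Poly_Mapping.single i 1 + Poly_Mapping.single i (- 1 :: int) = 0"
    by (simp only: single_add[symmetric] add.right_inverse single_zero)
  then show "mvar i * mmonom (Poly_Mapping.single i (- 1)) 1 = (1 :: 'a mfls)"
    by (simp only: mvar_def mmonom_mult_mmonom one_mfls_def mult_1)
qed

text \<open>
  The inverse of \<open>1 + a x\<^sub>i\<close> is its expansion as a power series in \<open>x\<^sub>i\<close>, namely
  \<open>\<Sum>l. (- a)\<^sup>l x\<^sub>i\<^sup>l\<close>.
\<close>

lemma keys_subset_single_iff: "Poly_Mapping.keys \<alpha> \<subseteq> {i} \<longleftrightarrow> (\<forall>j. j \<noteq> i \<longrightarrow> Poly_Mapping.lookup \<alpha> j = 0)"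
  by (auto simp: in_keys_iff)

lift_definition mgeom :: "'a::comm_ring_1 \<Rightarrow> nat \<Rightarrow> 'a mfls"
  is "\<lambda>a i \<alpha>. if Poly_Mapping.keys \<alpha> \<subseteq> {i} \<and> 0 \<le> Poly_Mapping.lookup \<alpha> i then (- a) ^ nat (Poly_Mapping.lookup \<alpha> i) else 0"
proof -
  fix a :: 'a and i
  have "\<alpha> \<in> expbox (Suc i)" if "Poly_Mapping.keys \<alpha> \<subseteq> {i}" "0 \<le> Poly_Mapping.lookup \<alpha> i" for \<alpha>
  proof -
    have "0 \<le> Poly_Mapping.lookup \<alpha> j" "Suc i \<le> j \<Longrightarrow> Poly_Mapping.lookup \<alpha> j = 0" for j
      using that by (cases "j = i"; simp add: keys_subset_single_iff)+
    then show ?thesis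
      unfolding expbox_def by (auto intro: order_trans[of _ 0])
  qed
  then show "\<exists>N. \<forall>\<alpha>. (if Poly_Mapping.keys \<alpha> \<subseteq> {i} \<and> 0 \<le> Poly_Mapping.lookup \<alpha> i then (- a) ^ nat (Poly_Mapping.lookup \<alpha> i) else 0) \<noteq> 0
      \<longrightarrow> \<alpha> \<in> expbox N"
    by (intro exI[of _ "Suc i"] allI impI) (simp split: if_splits)
qed

lemma inverse_one_plus_mconst_mvar: "inverse (1 + mconst a * mvar i) = mgeom a i"
proof (rule mfls_inverse_unique, rule mfls_eqI)
  fix \<alpha>
  have "mconst a * mvar i = mmonom (Poly_Mapping.single i 1) a"
    by (rule mfls_eqI) (simp add: mconst_def mvar_def mfls_coeff_mmonom_mult mfls_coeff_mmonom)
  then have *: "mfls_coeff ((1 + mconst a * mvar i) * mgeom a i) \<alpha>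
      = mfls_coeff (mgeom a i) \<alpha> + a * mfls_coeff (mgeom a i) (\<alpha> - Poly_Mapping.single i 1)"
    by (simp add: distrib_right plus_mfls.rep_eq mfls_coeff_mmonom_mult)
  have keys: "Poly_Mapping.keys (\<alpha> - Poly_Mapping.single i 1) \<subseteq> {i} \<longleftrightarrow> Poly_Mapping.keys \<alpha> \<subseteq> {i}"
    unfolding keys_subset_single_iff by (simp add: lookup_minus lookup_single_not_eq)
  have zero: "\<alpha> = 0 \<longleftrightarrow> Poly_Mapping.keys \<alpha> \<subseteq> {i} \<and> Poly_Mapping.lookup \<alpha> i = 0"
    unfolding keys_subset_single_iff by (auto simp: poly_mapping_eq_iff fun_eq_iff)
  have one: "mfls_coeff 1 \<alpha> = (if Poly_Mapping.keys \<alpha> \<subseteq> {i} \<and> Poly_Mapping.lookup \<alpha> i = 0 then 1 else 0 :: 'a)"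
    by (simp add: one_mfls_def mfls_coeff_mmonom zero)
  consider "Poly_Mapping.lookup \<alpha> i \<le> 0" | "0 < Poly_Mapping.lookup \<alpha> i" by linarith
  then show "mfls_coeff ((1 + mconst a * mvar i) * mgeom a i) \<alpha> = mfls_coeff 1 \<alpha>"
  proof cases
    case 1
    then show ?thesis
      unfolding * one mgeom.rep_eq keys by (simp add: lookup_minus)
  next
    case 2
    then have "nat (Poly_Mapping.lookup \<alpha> i) = Suc (nat (Poly_Mapping.lookup \<alpha> i - 1))" by linarith
    with 2 show ?thesis
      unfolding * one mgeom.rep_eq keys by (simp add: lookup_minus)
  qed
qed


section \<open>The indeterminates \<open>u\<close> and \<open>v\<close>\<close>

text \<open>The coefficient ring is \<open>\<int>[u][v]\<close>.\<close>

definition indet_u :: "int poly poly" where "indet_u = [:[:0, 1:]:]"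

definition indet_v :: "int poly poly" where "indet_v = [:0, 1:]"


section \<open>Gog trapezoids\<close>

definition gog_index :: "nat \<Rightarrow> nat \<Rightarrow> (nat \<times> nat) set" where
  "gog_index n k = {(i, j). 1 \<le> i \<and> i \<le> n \<and> 1 \<le> j \<and> j \<le> min i k}"

text \<open>
  An array is a function on all pairs that vanishes off the index set, so that distinct
  functions are distinct arrays.
\<close>

definition gog_trapezoid :: "nat \<Rightarrow> nat \<Rightarrow> nat \<Rightarrow> (nat \<Rightarrow> nat \<Rightarrow> nat) \<Rightarrow> bool" where
  "gog_trapezoid m n k G \<longleftrightarrow>
     (\<forall>i j. (i, j) \<notin> gog_index n k \<longrightarrow> G i j = 0) \<and>
     (\<forall>(i, j) \<in> gog_index n k. 0 < G i j) \<and>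
     (\<forall>(i, j) \<in> gog_index n k. (i + 1, j) \<in> gog_index n k \<longrightarrow> G (i + 1) j \<le> G i j) \<and>
     (\<forall>(i, j) \<in> gog_index n k. (i + 1, j + 1) \<in> gog_index n k \<longrightarrow> G i j \<le> G (i + 1) (j + 1)) \<and>
     (\<forall>(i, j) \<in> gog_index n k. (i, j + 1) \<in> gog_index n k \<longrightarrow> G i j < G i (j + 1)) \<and>
     (\<forall>(i, j) \<in> gog_index n k. G i j \<le> m + n - i + j)"

definition gog_trapezoids_with_bottom ::
    "nat \<Rightarrow> nat \<Rightarrow> nat \<Rightarrow> (nat \<Rightarrow> nat) \<Rightarrow> (nat \<Rightarrow> nat \<Rightarrow> nat) set" where
  "gog_trapezoids_with_bottom m n k b =
     {G. gog_trapezoid m n k G \<and> (\<forall>j \<in> {1..k}. G n j = b j)}"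

definition gog_inv :: "nat \<Rightarrow> nat \<Rightarrow> (nat \<Rightarrow> nat \<Rightarrow> nat) \<Rightarrow> nat" where
  "gog_inv n k G = card {(i, j). (i, j) \<in> gog_index n k \<and> (i + 1, j + 1) \<in> gog_index n k \<and>
                                 G i j = G (i + 1) (j + 1)}"

definition gog_inv' :: "nat \<Rightarrow> nat \<Rightarrow> (nat \<Rightarrow> nat \<Rightarrow> nat) \<Rightarrow> nat" where
  "gog_inv' n k G = card {(i, j). (i, j) \<in> gog_index n k \<and> (i + 1, j) \<in> gog_index n k \<and>
                                  G i j = G (i + 1) j}"

lemma finite_gog_trapezoids_with_bottom: "finite (gog_trapezoids_with_bottom m n k b)"
proof -
  let ?F = "{h. \<forall>p. (p \<in> {..n} \<times> {..k} \<longrightarrow> h p \<in> {..m + n + k}) \<and>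
                    (p \<notin> {..n} \<times> {..k} \<longrightarrow> h p = (0::nat))}"
  have le: "G i j \<le> m + n + k" if "gog_trapezoid m n k G" for G i j
  proof (cases "(i, j) \<in> gog_index n k")
    case True
    then have "G i j \<le> m + n - i + j" "j \<le> k"
      using that by (auto simp: gog_trapezoid_def gog_index_def)
    then show ?thesis by linarith
  next
    case False
    then show ?thesis using that by (simp add: gog_trapezoid_def)
  qed
  have "finite ?F"
    by (rule finite_set_of_finite_funs) auto
  moreover have "case_prod ` gog_trapezoids_with_bottom m n k b \<subseteq> ?F"
    using le by (auto simp: gog_trapezoids_with_bottom_def gog_trapezoid_def gog_index_def)
  ultimately have "finite (case_prod ` gog_trapezoids_with_bottom m n k b)"
    by (rule finite_subset[rotated])
  then show ?thesis
    by (rule finite_imageD) (rule inj_onI, metis curry_case_prod)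
qed

end

theory Submission
  imports Defs
begin

text \<open>
  Write \<open>X = 1 + x\<close>, \<open>L = 1 + u x\<close>, \<open>R = 1 + (1 - v) x\<close>, and let \<open>w(x, x') = L(x') R(x) + u v x x'\<close> be the
  non-antisymmetric factor of the product over pairs.  Induct on the number of rows, removing the
  bottom row \<open>b\<close>.  Without the strictness condition each entry \<open>c\<^sub>i\<close> of the next row runs freely
  through \<open>b\<^sub>i \<le> c\<^sub>i \<le> b\<^sub>i\<^sub>+\<^sub>1\<close>, and its weighted sum is
  \<open>x\<^sub>i\<inverse> (L X\<^sup>b\<^sup>' - R X\<^sup>b)\<close> with \<open>b = b\<^sub>i\<close>, \<open>b' = b\<^sub>i\<^sub>+\<^sub>1\<close>.  When \<open>c\<^sub>i\<close> contributes its upper and \<open>c\<^sub>i\<^sub>+\<^sub>1\<close> its lower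
  end, both carry the exponent \<open>b\<^sub>i\<^sub>+\<^sub>1\<close>, and the correction \<open>- u v\<close> for the forbidden case \<open>c\<^sub>i = c\<^sub>i\<^sub>+\<^sub>1\<close>
  completes the factor \<open>- L R\<close> to \<open>- w(x\<^sub>i\<^sub>+\<^sub>1, x\<^sub>i)\<close>; the integrand becomes antisymmetric in \<open>x\<^sub>i, x\<^sub>i\<^sub>+\<^sub>1\<close>, so these terms have constant term \<open>0\<close>.
  What survives is one term for each omitted index \<open>p\<close>: lower ends before \<open>p\<close>, upper ends after.

  On the other side, expanding the Vandermonde product along the powers \<open>x\<^sub>p\<^sup>n\<^sup>-\<^sup>1\<close> cancels the pole in
  \<open>x\<^sub>p\<close>, so \<open>x\<^sub>p\<close> may be set to \<open>0\<close>; as \<open>w(x\<^sub>i, 0) = R\<close> and \<open>w(0, x\<^sub>i) = L\<close>, this yields the same terms.  The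
  additional variables \<open>x\<^sub>k\<^sub>+\<^sub>1, \<dots>, x\<^sub>n\<close> fit in because their factors are carried to each other by the
  upper-end operation \<open>\<Phi> \<mapsto> x\<inverse> L \<Phi>\<close>, and all but the first of them vanish at \<open>0\<close>.
\<close>

section \<open>Renaming variables and setting a variable to zero\<close>

text \<open>\<open>map_key\<close> is composition with \<open>\<pi>\<close> only for injective
  \<open>\<pi>\<close>, and the support stays bounded because every variable is an image; hence the
  guard \<open>bij \<pi>\<close>.\<close>

lift_definition rename :: "(nat \<Rightarrow> nat) \<Rightarrow> 'a::zero mfls \<Rightarrow> 'a mfls"
  is "\<lambda>\<pi> f \<alpha>. if bij \<pi> then f (Poly_Mapping.map_key \<pi> \<alpha>) else 0"
proof -
  fix \<pi> :: "nat \<Rightarrow> nat" and f :: "(nat \<Rightarrow>\<^sub>0 int) \<Rightarrow> 'a"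
  assume "\<exists>N. \<forall>\<alpha>. f \<alpha> \<noteq> 0 \<longrightarrow> \<alpha> \<in> expbox N"
  then obtain N where N: "\<And>\<alpha>. f \<alpha> \<noteq> 0 \<Longrightarrow> \<alpha> \<in> expbox N" by blast
  \<comment> \<open>\<open>M\<close> exceeds \<open>\<pi> j\<close> for all \<open>j < N\<close>, so
    it bounds the renamed variables; being at least \<open>N\<close>, it also bounds their
    exponents.\<close>
  define M where "M = N + (\<Sum>i<N. Suc (\<pi> i))"
  have M: "\<pi> j < M" if "j < N" for j
  proof -
    have "Suc (\<pi> j) \<le> (\<Sum>i<N. Suc (\<pi> i))"
      using that by (intro member_le_sum) auto
    then show ?thesis by (simp add: M_def)
  qed
  have "\<alpha> \<in> expbox M" if bij: "bij \<pi>" and box: "Poly_Mapping.map_key \<pi> \<alpha> \<in> expbox N" for \<alpha>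
  proof -
    have l: "Poly_Mapping.lookup \<alpha> (\<pi> j) = Poly_Mapping.lookup (Poly_Mapping.map_key \<pi> \<alpha>) j" for j
      using bij_is_inj[OF bij] by (simp add: map_key.rep_eq)
    have "- int M \<le> Poly_Mapping.lookup \<alpha> i" "M \<le> i \<Longrightarrow> Poly_Mapping.lookup \<alpha> i = 0" for i
    proof -
      obtain j where j: "i = \<pi> j" using surjD[OF bij_is_surj[OF bij]] by blast
      have "- int N \<le> Poly_Mapping.lookup \<alpha> (\<pi> j)"
        using box by (cases "j < N") (simp_all add: l expbox_def)
      moreover have "int N \<le> int M" unfolding of_nat_le_iff M_def by (rule le_add1)
      ultimately show "- int M \<le> Poly_Mapping.lookup \<alpha> i" unfolding j by linarith
      assume "M \<le> i"
      then have "N \<le> j" using M[of j] j by (cases "j < N") simp_all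
      then show "Poly_Mapping.lookup \<alpha> i = 0"
        using box by (simp add: j l expbox_def)
    qed
    then show ?thesis by (simp add: expbox_def)
  qed
  then show "\<exists>N. \<forall>\<alpha>. (if bij \<pi> then f (Poly_Mapping.map_key \<pi> \<alpha>) else 0) \<noteq> 0 \<longrightarrow> \<alpha> \<in> expbox N"
    using N by (intro exI[of _ M]) simp
qed

lemma mfls_coeff_rename:
  "bij \<pi> \<Longrightarrow> mfls_coeff (rename \<pi> f) \<alpha> = mfls_coeff f (Poly_Mapping.map_key \<pi> \<alpha>)"
  by (simp add: rename.rep_eq)

lemma map_key_minus:
  fixes \<alpha> \<beta> :: "nat \<Rightarrow>\<^sub>0 int"
  assumes "inj \<pi>"
  shows "Poly_Mapping.map_key \<pi> (\<alpha> - \<beta>) = Poly_Mapping.map_key \<pi> \<alpha> - Poly_Mapping.map_key \<pi> \<beta>"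
  by (rule poly_mapping_eqI) (simp add: map_key.rep_eq assms lookup_minus)

lemma bij_map_key:
  fixes \<pi> :: "nat \<Rightarrow> nat"
  assumes "bij \<pi>"
  shows "bij (Poly_Mapping.map_key \<pi> :: (nat \<Rightarrow>\<^sub>0 int) \<Rightarrow> (nat \<Rightarrow>\<^sub>0 int))"
proof (rule o_bij)
  have inj: "inj \<pi>" "inj (inv \<pi>)"
    using assms by (simp_all add: bij_is_inj bij_imp_bij_inv)
  show "Poly_Mapping.map_key (inv \<pi>) \<circ> Poly_Mapping.map_key \<pi> = (id :: (nat \<Rightarrow>\<^sub>0 int) \<Rightarrow> _)"
  proof (rule ext, rule poly_mapping_eqI)
    fix \<alpha> :: "nat \<Rightarrow>\<^sub>0 int" and i
    have "\<pi> (inv \<pi> i) = i" using bij_is_surj[OF assms] by (rule surj_f_inv_f)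
    then show "Poly_Mapping.lookup ((Poly_Mapping.map_key (inv \<pi>) \<circ> Poly_Mapping.map_key \<pi>) \<alpha>) i = Poly_Mapping.lookup (id \<alpha>) i"
      by (simp add: map_key.rep_eq inj)
  qed
  show "Poly_Mapping.map_key \<pi> \<circ> Poly_Mapping.map_key (inv \<pi>) = (id :: (nat \<Rightarrow>\<^sub>0 int) \<Rightarrow> _)"
    by (rule ext, rule poly_mapping_eqI) (simp add: map_key.rep_eq inj)
qed

text \<open>The exponent vector 0 is fixed. This allows relabelling after a variable is removed and
  makes antisymmetric integrands vanish.\<close>

lemma constant_term_rename: "bij \<pi> \<Longrightarrow> constant_term (rename \<pi> f) = constant_term f"
  by (simp add: constant_term_def mfls_coeff_rename map_key_zero bij_is_inj)

lemma rename_mmonom: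
  assumes "bij \<pi>" "Poly_Mapping.map_key \<pi> \<beta> = \<alpha>"
  shows "rename \<pi> (mmonom \<alpha> c) = mmonom \<beta> c"
proof (rule mfls_eqI)
  fix \<gamma>
  have "Poly_Mapping.map_key \<pi> \<gamma> = \<alpha> \<longleftrightarrow> \<gamma> = \<beta>"
    unfolding assms(2)[symmetric] by (rule inj_eq[OF bij_is_inj[OF bij_map_key[OF assms(1)]]])
  then show "mfls_coeff (rename \<pi> (mmonom \<alpha> c)) \<gamma> = mfls_coeff (mmonom \<beta> c) \<gamma>"
    by (simp add: mfls_coeff_rename assms(1) mfls_coeff_mmonom)
qed

lemma rename_mconst: "bij \<pi> \<Longrightarrow> rename \<pi> (mconst c) = mconst c"
  unfolding mconst_def by (rule rename_mmonom) (simp_all add: map_key_zero bij_is_inj)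

lemma rename_mvar: "bij \<pi> \<Longrightarrow> rename \<pi> (mvar i) = mvar (\<pi> i)"
  unfolding mvar_def by (rule rename_mmonom) (simp_all add: map_key_single bij_is_inj)

lemma rename_1: "bij \<pi> \<Longrightarrow> rename \<pi> (1 :: 'a::comm_ring_1 mfls) = 1"
  unfolding one_mfls_def by (rule rename_mmonom) (simp_all add: map_key_zero bij_is_inj)

lemma rename_add: "bij \<pi> \<Longrightarrow> rename \<pi> (f + g :: 'a::comm_ring_1 mfls) = rename \<pi> f + rename \<pi> g"
  by (rule mfls_eqI) (simp add: mfls_coeff_rename plus_mfls.rep_eq)

lemma rename_uminus: "bij \<pi> \<Longrightarrow> rename \<pi> (- f :: 'a::comm_ring_1 mfls) = - rename \<pi> f"
  by (rule mfls_eqI) (simp add: mfls_coeff_rename uminus_mfls.rep_eq)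

lemma rename_diff: "bij \<pi> \<Longrightarrow> rename \<pi> (f - g :: 'a::comm_ring_1 mfls) = rename \<pi> f - rename \<pi> g"
  by (simp only: minus_mfls_def rename_add rename_uminus)

lemma rename_mult:
  fixes f g :: "'a::comm_ring_1 mfls"
  assumes "bij \<pi>"
  shows "rename \<pi> (f * g) = rename \<pi> f * rename \<pi> g"
proof (rule mfls_eqI)
  fix \<alpha>
  let ?m = "Poly_Mapping.map_key \<pi> :: (nat \<Rightarrow>\<^sub>0 int) \<Rightarrow> _"
  have bij: "bij ?m" using assms by (rule bij_map_key)
  have "bij_betw ?m {\<beta>. mfls_coeff f (?m \<beta>) \<noteq> 0 \<and> mfls_coeff g (?m \<alpha> - ?m \<beta>) \<noteq> 0}
      {\<beta>. mfls_coeff f \<beta> \<noteq> 0 \<and> mfls_coeff g (?m \<alpha> - \<beta>) \<noteq> 0}"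
    unfolding bij_betw_def
  proof (intro conjI inj_on_subset[OF bij_is_inj[OF bij] subset_UNIV] equalityI subsetI)
    fix \<beta> assume b: "\<beta> \<in> {\<beta>. mfls_coeff f \<beta> \<noteq> 0 \<and> mfls_coeff g (?m \<alpha> - \<beta>) \<noteq> 0}"
    obtain \<beta>' where "\<beta> = ?m \<beta>'" using surjD[OF bij_is_surj[OF bij]] by blast
    with b show "\<beta> \<in> ?m ` {\<beta>. mfls_coeff f (?m \<beta>) \<noteq> 0 \<and> mfls_coeff g (?m \<alpha> - ?m \<beta>) \<noteq> 0}" by blast
  qed auto
  from sum.reindex_bij_betw[OF this, of "\<lambda>\<beta>. mfls_coeff f \<beta> * mfls_coeff g (?m \<alpha> - \<beta>)"]
  show "mfls_coeff (rename \<pi> (f * g)) \<alpha> = mfls_coeff (rename \<pi> f * rename \<pi> g) \<alpha>"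
    by (simp add: mfls_coeff_rename assms times_mfls.rep_eq map_key_minus bij_is_inj)
qed

lemma rename_power:
  "bij \<pi> \<Longrightarrow> rename \<pi> (f ^ n :: 'a::comm_ring_1 mfls) = rename \<pi> f ^ n"
  by (induction n) (simp_all add: rename_1 rename_mult)

lemma rename_prod:
  "bij \<pi> \<Longrightarrow> rename \<pi> (\<Prod>i\<in>A. f i :: 'a::comm_ring_1 mfls) = (\<Prod>i\<in>A. rename \<pi> (f i))"
  by (induction A rule: infinite_finite_induct) (simp_all add: rename_1 rename_mult)

text \<open>As the inverse of a non-unit is 0, exhibiting one nonzero coefficient of the inverse
  proves that a series is a unit.\<close>

lemma unit_mult_inverse:
  fixes f :: "'a::comm_ring_1 mfls"
  assumes "inverse f \<noteq> 0"
  shows "f * inverse f = 1"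
proof -
  obtain g where "f * g = 1"
    using assms unfolding inverse_mfls_def by (auto split: if_splits)
  with mfls_inverse_unique[OF this] show ?thesis by simp
qed

lemma mvar_mult_inverse: "mvar i * inverse (mvar i) = (1 :: 'a::comm_ring_1 mfls)"
proof (rule unit_mult_inverse)
  have "mfls_coeff (inverse (mvar i) :: 'a mfls) (Poly_Mapping.single i (- 1)) \<noteq> mfls_coeff 0 (Poly_Mapping.single i (- 1))"
    by (simp add: inverse_mvar mfls_coeff_mmonom zero_mfls.rep_eq)
  then show "inverse (mvar i :: 'a mfls) \<noteq> 0" by metis
qed

lemma one_plus_mult_inverse:
  "(1 + mconst a * mvar i) * inverse (1 + mconst a * mvar i) = (1 :: 'a::comm_ring_1 mfls)"
proof (rule unit_mult_inverse)
  have "mfls_coeff (inverse (1 + mconst a * mvar i)) 0 \<noteq> mfls_coeff 0 0"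
    by (simp add: inverse_one_plus_mconst_mvar mgeom.rep_eq zero_mfls.rep_eq)
  then show "inverse (1 + mconst a * mvar i) \<noteq> 0" by metis
qed

lemma rename_inverse:
  fixes f :: "'a::comm_ring_1 mfls"
  assumes "bij \<pi>" "f * inverse f = 1"
  shows "rename \<pi> (inverse f) = inverse (rename \<pi> f)"
proof -
  have "rename \<pi> f * rename \<pi> (inverse f) = 1"
    using assms by (simp flip: rename_mult add: rename_1)
  from mfls_inverse_unique[OF this] show ?thesis by simp
qed

section \<open>Linearity of the constant term, and constant series\<close>

lemma constant_term_add: "constant_term (f + g :: 'a::comm_ring_1 mfls) = constant_term f + constant_term g"
  by (simp add: constant_term_def plus_mfls.rep_eq)

lemma constant_term_uminus: "constant_term (- f :: 'a::comm_ring_1 mfls) = - constant_term f"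
  by (simp add: constant_term_def uminus_mfls.rep_eq)

lemma constant_term_diff: "constant_term (f - g :: 'a::comm_ring_1 mfls) = constant_term f - constant_term g"
  using constant_term_add[of f "- g"] by (simp add: constant_term_uminus)

lemma constant_term_0: "constant_term (0 :: 'a::comm_ring_1 mfls) = 0"
  by (simp add: constant_term_def zero_mfls.rep_eq)

lemma constant_term_sum: "constant_term (\<Sum>i\<in>A. f i :: 'a::comm_ring_1 mfls) = (\<Sum>i\<in>A. constant_term (f i))"
  by (induction A rule: infinite_finite_induct) (simp_all add: constant_term_0 constant_term_add)

lemma constant_term_mconst_mult: "constant_term (mconst c * f :: 'a::comm_ring_1 mfls) = c * constant_term f"
  by (simp add: constant_term_def mconst_def mfls_coeff_mmonom_mult)

lemma constant_term_1: "constant_term (1 :: 'a::comm_ring_1 mfls) = 1"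
  by (simp add: constant_term_def one_mfls_def mfls_coeff_mmonom)

lemma mconst_mult: "mconst (c * d) = mconst c * (mconst d :: 'a::comm_ring_1 mfls)"
  by (simp add: mconst_def mmonom_mult_mmonom)

lemma mconst_1: "mconst 1 = (1 :: 'a::comm_ring_1 mfls)"
  by (simp add: mconst_def one_mfls_def)

lemma mconst_0: "mconst 0 = (0 :: 'a::comm_ring_1 mfls)"
  by (rule mfls_eqI) (simp add: mconst_def mfls_coeff_mmonom zero_mfls.rep_eq)

lemma mconst_prod: "mconst (\<Prod>i\<in>A. f i) = (\<Prod>i\<in>A. mconst (f i) :: 'a::comm_ring_1 mfls)"
  by (induction A rule: infinite_finite_induct) (simp_all add: mconst_1 mconst_mult)

section \<open>Series without a pole in one variable, and setting that variable to zero\<close>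

definition regular_at :: "nat \<Rightarrow> 'a::comm_ring_1 mfls set" where
  "regular_at p = {f. \<forall>\<alpha>. mfls_coeff f \<alpha> \<noteq> 0 \<longrightarrow> 0 \<le> Poly_Mapping.lookup \<alpha> p}"

lemma regular_at_mmonom: "0 \<le> Poly_Mapping.lookup \<alpha> p \<Longrightarrow> mmonom \<alpha> c \<in> regular_at p"
  by (simp add: regular_at_def mfls_coeff_mmonom)

lemma regular_at_mconst: "mconst c \<in> regular_at p"
  by (simp add: mconst_def regular_at_mmonom)

lemma regular_at_0: "0 \<in> regular_at p"
  by (simp add: regular_at_def zero_mfls.rep_eq)

lemma regular_at_1: "1 \<in> regular_at p"
  by (simp add: one_mfls_def regular_at_mmonom)

lemma regular_at_mvar: "mvar i \<in> regular_at p"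
  by (simp add: mvar_def regular_at_mmonom lookup_single when_def)

lemma regular_at_inverse_mvar: "i \<noteq> p \<Longrightarrow> inverse (mvar i) \<in> regular_at p"
  by (simp add: inverse_mvar regular_at_mmonom lookup_single)

lemma regular_at_inverse: "inverse (1 + mconst a * mvar i) \<in> regular_at p"
proof -
  have "0 \<le> Poly_Mapping.lookup \<alpha> p" if "Poly_Mapping.keys \<alpha> \<subseteq> {i}" "0 \<le> Poly_Mapping.lookup \<alpha> i"
    for \<alpha> :: "nat \<Rightarrow>\<^sub>0 int"
    using that by (cases "p = i") (simp_all add: keys_subset_single_iff)
  then show ?thesis by (simp add: inverse_one_plus_mconst_mvar regular_at_def mgeom.rep_eq)
qed

lemma regular_at_add: "f \<in> regular_at p \<Longrightarrow> g \<in> regular_at p \<Longrightarrow> f + g \<in> regular_at p"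
  by (simp add: regular_at_def plus_mfls.rep_eq) (metis add.right_neutral)

lemma regular_at_uminus: "f \<in> regular_at p \<Longrightarrow> - f \<in> regular_at p"
  by (simp add: regular_at_def uminus_mfls.rep_eq)

lemma regular_at_diff: "f \<in> regular_at p \<Longrightarrow> g \<in> regular_at p \<Longrightarrow> f - g \<in> regular_at p"
  by (simp only: minus_mfls_def regular_at_add regular_at_uminus)

lemma regular_at_mult:
  assumes "f \<in> regular_at p" "g \<in> regular_at p"
  shows "f * g \<in> regular_at p"
  unfolding regular_at_def
proof (clarify)
  fix \<alpha> assume "mfls_coeff (f * g) \<alpha> \<noteq> 0"
  then obtain \<beta> where "mfls_coeff f \<beta> \<noteq> 0" "mfls_coeff g (\<alpha> - \<beta>) \<noteq> 0"
    unfolding times_mfls.rep_eq by (metis (mono_tags, lifting) mem_Collect_eq sum.neutral mult_zero_left mult_zero_right)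
  with assms have "0 \<le> Poly_Mapping.lookup \<beta> p" "0 \<le> Poly_Mapping.lookup (\<alpha> - \<beta>) p"
    by (simp_all add: regular_at_def)
  then show "0 \<le> Poly_Mapping.lookup \<alpha> p" by (simp add: lookup_minus)
qed

lemma regular_at_prod: "(\<And>i. i \<in> A \<Longrightarrow> f i \<in> regular_at p) \<Longrightarrow> (\<Prod>i\<in>A. f i) \<in> regular_at p"
  by (induction A rule: infinite_finite_induct) (simp_all add: regular_at_1 regular_at_mult)

lemma regular_at_power: "f \<in> regular_at p \<Longrightarrow> f ^ n \<in> regular_at p"
  by (induction n) (simp_all add: regular_at_1 regular_at_mult)

lemmas regular_at_intros = regular_at_mconst regular_at_1 regular_at_mvar regular_at_inverse_mvar
  regular_at_inverse regular_at_add regular_at_uminus regular_at_diff regular_at_mult regular_at_prod regular_at_power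

text \<open>Substitution of 0 for the variable at \<open>p\<close>, encoded as congruence modulo
  \<open>mvar p\<close> in the ring \<open>regular_at p\<close>; compatibility with sums and
  products is then that of an ideal.\<close>

definition eq_at_0 :: "nat \<Rightarrow> 'a::comm_ring_1 mfls \<Rightarrow> 'a mfls \<Rightarrow> bool" where
  "eq_at_0 p f g \<longleftrightarrow> f \<in> regular_at p \<and> g \<in> regular_at p \<and> (\<exists>h \<in> regular_at p. f - g = mvar p * h)"

text \<open>The constant term of \<open>mvar p * h\<close> is a coefficient of \<open>h\<close> with
  exponent -1 at \<open>p\<close>, which is 0 by regularity.\<close>

lemma constant_term_eq_at_0:
  assumes "eq_at_0 p f g"
  shows "constant_term f = constant_term g"
proof -
  obtain h where h: "h \<in> regular_at p" "f - g = mvar p * h" using assms by (auto simp: eq_at_0_def)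
  have "constant_term (mvar p * h) = mfls_coeff h (- Poly_Mapping.single p 1)"
    by (simp add: constant_term_def mvar_def mfls_coeff_mmonom_mult)
  also have "\<dots> = 0"
    using h(1) by (force simp: regular_at_def)
  finally show ?thesis using h(2) constant_term_diff[of f g] by simp
qed

lemma eq_at_0_refl: "f \<in> regular_at p \<Longrightarrow> eq_at_0 p f f"
  unfolding eq_at_0_def by (intro conjI bexI[of _ 0]) (simp_all add: regular_at_0)

lemma eq_at_0_mult:
  assumes "eq_at_0 p f g" "eq_at_0 p f' g'"
  shows "eq_at_0 p (f * f') (g * g')"
proof -
  obtain h h' where h: "h \<in> regular_at p" "f - g = mvar p * h" "h' \<in> regular_at p" "f' - g' = mvar p * h'"
    using assms by (auto simp: eq_at_0_def)
  have "f * f' - g * g' = (f - g) * f' + g * (f' - g')" by (simp add: algebra_simps)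
  also have "\<dots> = mvar p * (h * f' + g * h')" unfolding h(2,4) by (simp add: algebra_simps)
  finally show ?thesis
    using assms h unfolding eq_at_0_def by (blast intro: regular_at_mult regular_at_add)
qed

lemma eq_at_0_add:
  assumes "eq_at_0 p f g" "eq_at_0 p f' g'"
  shows "eq_at_0 p (f + f') (g + g')"
proof -
  obtain h h' where h: "h \<in> regular_at p" "f - g = mvar p * h" "h' \<in> regular_at p" "f' - g' = mvar p * h'"
    using assms by (auto simp: eq_at_0_def)
  have "f + f' - (g + g') = (f - g) + (f' - g')" by (simp add: algebra_simps)
  also have "\<dots> = mvar p * (h + h')" unfolding h(2,4) by (simp add: algebra_simps)
  finally show ?thesis
    using assms h unfolding eq_at_0_def by (blast intro: regular_at_add)
qed

lemma eq_at_0_prod: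
  "(\<And>i. i \<in> A \<Longrightarrow> eq_at_0 p (f i) (g i)) \<Longrightarrow> eq_at_0 p (\<Prod>i\<in>A. f i) (\<Prod>i\<in>A. g i)"
  by (induction A rule: infinite_finite_induct) (simp_all add: eq_at_0_refl regular_at_1 eq_at_0_mult)

lemma eq_at_0_power: "eq_at_0 p f g \<Longrightarrow> eq_at_0 p (f ^ n) (g ^ n)"
  by (induction n) (simp_all add: eq_at_0_refl regular_at_1 eq_at_0_mult)

lemma eq_at_0_mvar: "eq_at_0 p (mvar p) 0"
  unfolding eq_at_0_def
  by (intro conjI bexI[of _ 1]) (simp_all add: regular_at_mvar regular_at_0 regular_at_1)

text \<open>
  \<open>(x\<^sub>i - x\<^sub>j) f = 0\<close> makes the coefficients of \<open>f\<close> constant along the direction of \<open>x\<^sub>i / x\<^sub>j\<close>, which leaves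
  every box.
\<close>

lemma mvar_diff_cancel:
  fixes f :: "'a::comm_ring_1 mfls"
  assumes "i \<noteq> j" "(mvar i - mvar j) * f = 0"
  shows "f = 0"
proof (rule mfls_eqI)
  fix \<alpha>
  define \<delta> where "\<delta> = Poly_Mapping.single i 1 - Poly_Mapping.single j (1::int)"
  have "mvar i * f = mvar j * f" using assms(2) by (simp add: algebra_simps)
  then have "mfls_coeff f (\<gamma> - Poly_Mapping.single i 1) = mfls_coeff f (\<gamma> - Poly_Mapping.single j 1)" for \<gamma>
    unfolding mvar_def by (metis mfls_coeff_mmonom_mult mult_1)
  from this[of "_ + Poly_Mapping.single i 1"]
  have step: "mfls_coeff f \<gamma> = mfls_coeff f (\<gamma> + \<delta>)" for \<gamma>
    by (simp add: \<delta>_def algebra_simps)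
  have lk: "Poly_Mapping.lookup \<delta> j = -1" using assms(1) by (simp add: \<delta>_def lookup_minus lookup_single)
  have "\<exists>\<gamma>. mfls_coeff f \<gamma> = mfls_coeff f \<alpha> \<and> Poly_Mapping.lookup \<gamma> j = Poly_Mapping.lookup \<alpha> j - int r" for r
  proof (induction r)
    case (Suc r)
    then obtain \<gamma> where "mfls_coeff f \<gamma> = mfls_coeff f \<alpha>" "Poly_Mapping.lookup \<gamma> j = Poly_Mapping.lookup \<alpha> j - int r"
      by blast
    then show ?case by (intro exI[of _ "\<gamma> + \<delta>"]) (simp add: step[symmetric] lookup_add lk)
  qed auto
  note * = this
  obtain N where N: "\<And>\<alpha>. mfls_coeff f \<alpha> \<noteq> 0 \<Longrightarrow> \<alpha> \<in> expbox N" using mfls_bound[of f] by blast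
  obtain \<gamma> where g: "mfls_coeff f \<gamma> = mfls_coeff f \<alpha>"
    "Poly_Mapping.lookup \<gamma> j = Poly_Mapping.lookup \<alpha> j - int (nat (Poly_Mapping.lookup \<alpha> j + int N + 1))"
    using *[of "nat (Poly_Mapping.lookup \<alpha> j + int N + 1)"] by blast
  \<comment> \<open>The number of steps brings the exponent at \<open>j\<close> down to
    \<open>- N - 1\<close>; where \<open>nat\<close> truncates, \<open>\<alpha>\<close> itself is
    already below the box.\<close>
  have "Poly_Mapping.lookup \<gamma> j < - int N \<or> Poly_Mapping.lookup \<alpha> j < - int N" using g(2) by linarith
  moreover have "Poly_Mapping.lookup \<beta> j < - int N \<Longrightarrow> \<beta> \<notin> expbox N" for \<beta>
    by (cases "j < N") (auto simp: expbox_def intro: exI[of _ j])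
  ultimately show "mfls_coeff f \<alpha> = mfls_coeff 0 \<alpha>"
    using N[of \<gamma>] N[of \<alpha>] g(1) by (auto simp: zero_mfls.rep_eq)
qed

section \<open>Vandermonde products\<close>

definition pairs :: "nat set \<Rightarrow> (nat \<times> nat) set" where
  "pairs S = {(i, j). i \<in> S \<and> j \<in> S \<and> i < j}"

lemma finite_pairs: "finite S \<Longrightarrow> finite (pairs S)"
  by (rule finite_subset[of _ "S \<times> S"]) (auto simp: pairs_def)

text \<open>Pairs with \<open>p\<close> in second and in first place are kept apart because
  \<open>w\<close> is not symmetric: the former will yield factors \<open>R\<close>, the latter
  factors \<open>L\<close>.\<close>

lemma prod_pairs_remove:
  fixes f :: "nat \<times> nat \<Rightarrow> 'a::comm_monoid_mult"
  assumes "finite S" "p \<in> S"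
  shows "prod f (pairs S) = (\<Prod>i\<in>{i\<in>S. i < p}. f (i, p)) * (\<Prod>i\<in>{i\<in>S. p < i}. f (p, i)) * prod f (pairs (S - {p}))"
proof -
  let ?A = "(\<lambda>i. (i, p)) ` {i\<in>S. i < p}" and ?B = "(\<lambda>i. (p, i)) ` {i\<in>S. p < i}"
  have "pairs S = ?A \<union> ?B \<union> pairs (S - {p})"
    using assms(2) by (auto simp: pairs_def image_iff)
  then have "prod f (pairs S) = prod f (?A \<union> ?B \<union> pairs (S - {p}))" by simp
  also have "\<dots> = prod f (?A \<union> ?B) * prod f (pairs (S - {p}))"
    using assms(1) by (intro prod.union_disjoint) (auto simp: finite_pairs, auto simp: pairs_def)
  also have "prod f (?A \<union> ?B) = prod f ?A * prod f ?B"
    using assms(1) by (intro prod.union_disjoint) auto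
  also have "prod f ?A = (\<Prod>i\<in>{i\<in>S. i < p}. f (i, p))"
    by (subst prod.reindex) (auto simp: inj_on_def)
  also have "prod f ?B = (\<Prod>i\<in>{i\<in>S. p < i}. f (p, i))"
    by (subst prod.reindex) (auto simp: inj_on_def)
  finally show ?thesis .
qed

text \<open>Monotonicity preserves the order inside each pair, so a product of non-symmetric factors
  can be relabelled.\<close>

lemma prod_pairs_image:
  assumes "strict_mono_on S \<pi>"
  shows "prod f (pairs (\<pi> ` S)) = (\<Prod>(i, j)\<in>pairs S. f (\<pi> i, \<pi> j))"
proof -
  have less: "\<pi> i < \<pi> j \<longleftrightarrow> i < j" if "i \<in> S" "j \<in> S" for i j
    using assms that by (metis linorder_neqE_nat order_less_asym order_less_irrefl strict_mono_onD)
  have "inj_on \<pi> S" using assms by (rule strict_mono_on_imp_inj_on)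
  then have "inj_on (map_prod \<pi> \<pi>) (pairs S)"
    by (auto simp: pairs_def inj_on_def)
  moreover have "pairs (\<pi> ` S) = map_prod \<pi> \<pi> ` pairs S"
    using less by (force simp: pairs_def image_iff)
  ultimately show ?thesis
    by (simp add: prod.reindex case_prod_unfold map_prod_def)
qed

section \<open>The Vandermonde product as an expansion along its first column\<close>

definition vandermonde :: "(nat \<Rightarrow> 'a::comm_ring_1) \<Rightarrow> nat set \<Rightarrow> 'a" where
  "vandermonde x S = (\<Prod>(i, j)\<in>pairs S. x i - x j)"

text \<open>
  The Laplace expansion of a determinant with first column \<open>f\<close> and the Vandermonde columns
  \<open>x\<^sup>n\<^sup>-\<^sup>2, \<dots>, x, 1\<close>.
\<close>

definition first_column :: "(nat \<Rightarrow> 'a::comm_ring_1) \<Rightarrow> nat set \<Rightarrow> (nat \<Rightarrow> 'a) \<Rightarrow> 'a" where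
  "first_column x S f = (\<Sum>p\<in>S. (- 1) ^ card {i\<in>S. i < p} * f p * vandermonde x (S - {p}))"

context
  fixes x :: "nat \<Rightarrow> 'a::comm_ring_1"
begin

lemma first_column_diff: "first_column x S (\<lambda>p. f p - g p) = first_column x S f - first_column x S g"
  by (simp add: first_column_def algebra_simps sum_subtractf)

lemma first_column_mult: "first_column x S (\<lambda>p. c * f p) = c * first_column x S f"
  by (simp add: first_column_def sum_distrib_left algebra_simps)

lemma vandermonde_Max:
  assumes "finite S" "z \<in> S" "\<And>i. i \<in> S \<Longrightarrow> i \<le> z"
  shows "vandermonde x S = (\<Prod>i\<in>S - {z}. x i - x z) * vandermonde x (S - {z})"
proof -
  have eqs: "{i\<in>S. i < z} = S - {z}" "{i\<in>S. z < i} = {}" using assms(3) by (auto simp: less_le not_le dest: leD)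
  show ?thesis
    unfolding vandermonde_def prod_pairs_remove[OF assms(1,2)] eqs by simp
qed

lemma vandermonde_Min:
  assumes "finite S" "a \<in> S" "\<And>i. i \<in> S \<Longrightarrow> a \<le> i"
  shows "vandermonde x S = (\<Prod>i\<in>S - {a}. x a - x i) * vandermonde x (S - {a})"
proof -
  have eqs: "{i\<in>S. a < i} = S - {a}" "{i\<in>S. i < a} = {}" using assms(3) by (auto simp: less_le not_le dest: leD)
  show ?thesis
    unfolding vandermonde_def prod_pairs_remove[OF assms(1,2)] eqs by simp
qed

text \<open>The term \<open>p = z\<close> vanishes. In every other term \<open>x p - x z\<close>
  supplies the one difference with \<open>z\<close> that is missing from the Vandermonde product
  over \<open>S - {p}\<close>, so the full product over \<open>S - {z}\<close> comes out.\<close>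

lemma first_column_Max:
  assumes "finite S" "z \<in> S" "\<And>i. i \<in> S \<Longrightarrow> i \<le> z"
  shows "first_column x S (\<lambda>p. (x p - x z) * h p) = (\<Prod>i\<in>S - {z}. x i - x z) * first_column x (S - {z}) h"
proof -
  have "first_column x S (\<lambda>p. (x p - x z) * h p)
      = (\<Sum>p\<in>S - {z}. (- 1) ^ card {i\<in>S. i < p} * ((x p - x z) * h p) * vandermonde x (S - {p}))"
    unfolding first_column_def using assms(1,2) by (subst sum.remove[of S z]) auto
  also have "\<dots> = (\<Sum>p\<in>S - {z}. (\<Prod>i\<in>S - {z}. x i - x z) *
      ((- 1) ^ card {i\<in>S - {z}. i < p} * h p * vandermonde x (S - {z} - {p})))"
  proof (rule sum.cong[OF refl])
    fix p assume p: "p \<in> S - {z}"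
    then have c: "{i\<in>S. i < p} = {i\<in>S - {z}. i < p}" using assms(3) by fastforce
    have "vandermonde x (S - {p}) = (\<Prod>i\<in>S - {p} - {z}. x i - x z) * vandermonde x (S - {p} - {z})"
      using assms p by (intro vandermonde_Max) auto
    moreover have "(\<Prod>i\<in>S - {z}. x i - x z) = (x p - x z) * (\<Prod>i\<in>S - {z} - {p}. x i - x z)"
      using assms(1) p by (intro prod.remove) auto
    moreover have "S - {p} - {z} = S - {z} - {p}" by auto
    ultimately show "(- 1) ^ card {i\<in>S. i < p} * ((x p - x z) * h p) * vandermonde x (S - {p})
        = (\<Prod>i\<in>S - {z}. x i - x z) * ((- 1) ^ card {i\<in>S - {z}. i < p} * h p * vandermonde x (S - {z} - {p}))"
      by (simp only: c mult_ac)
  qed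
  finally show ?thesis by (simp only: first_column_def sum_distrib_left)
qed

text \<open>As for the maximum, with two compensating signs: removing \<open>a\<close> lowers each
  sign exponent by one, and the missing difference is \<open>x a - x p\<close> instead of
  \<open>x p - x a\<close>.\<close>

lemma first_column_Min:
  assumes "finite S" "a \<in> S" "\<And>i. i \<in> S \<Longrightarrow> a \<le> i"
  shows "first_column x S (\<lambda>p. (x p - x a) * h p) = (\<Prod>i\<in>S - {a}. x a - x i) * first_column x (S - {a}) h"
proof -
  have "first_column x S (\<lambda>p. (x p - x a) * h p)
      = (\<Sum>p\<in>S - {a}. (- 1) ^ card {i\<in>S. i < p} * ((x p - x a) * h p) * vandermonde x (S - {p}))"
    unfolding first_column_def using assms(1,2) by (subst sum.remove[of S a]) auto
  also have "\<dots> = (\<Sum>p\<in>S - {a}. (\<Prod>i\<in>S - {a}. x a - x i) *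
      ((- 1) ^ card {i\<in>S - {a}. i < p} * h p * vandermonde x (S - {a} - {p})))"
  proof (rule sum.cong[OF refl])
    fix p assume p: "p \<in> S - {a}"
    then have "a < p" using assms(3)[of p] by auto
    then have "{i\<in>S. i < p} = insert a {i\<in>S - {a}. i < p}" using assms(2) by auto
    then have c: "(- 1) ^ card {i\<in>S. i < p} = - ((- 1 :: 'a) ^ card {i\<in>S - {a}. i < p})"
      using assms(1) by simp
    have "vandermonde x (S - {p}) = (\<Prod>i\<in>S - {p} - {a}. x a - x i) * vandermonde x (S - {p} - {a})"
      using assms p by (intro vandermonde_Min) auto
    moreover have "(\<Prod>i\<in>S - {a}. x a - x i) = - ((x p - x a) * (\<Prod>i\<in>S - {a} - {p}. x a - x i))"
      using assms(1) p by (subst prod.remove[of _ p]) (auto simp: algebra_simps)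
    moreover have "S - {p} - {a} = S - {a} - {p}" by auto
    ultimately show "(- 1) ^ card {i\<in>S. i < p} * ((x p - x a) * h p) * vandermonde x (S - {p})
        = (\<Prod>i\<in>S - {a}. x a - x i) * ((- 1) ^ card {i\<in>S - {a}. i < p} * h p * vandermonde x (S - {a} - {p}))"
      by (simp only: c mult_minus_left mult_minus_right mult_ac)
  qed
  finally show ?thesis by (simp only: first_column_def sum_distrib_left)
qed

lemma first_column_singleton: "first_column x {a} f = f a"
proof -
  have "first_column x {a} f = (- 1) ^ card {i\<in>{a}. i < a} * f a * vandermonde x {}"
    by (simp add: first_column_def)
  also have "{i\<in>{a}. i < a} = {}" by auto
  finally show ?thesis by (simp add: vandermonde_def pairs_def)
qed

text \<open>For \<open>j < n\<close> this is a determinant with a repeated column, for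
  \<open>j = n\<close> the Vandermonde determinant. Cancellation of differences takes the place of
  division.\<close>

lemma first_column_power:
  assumes cancel: "\<And>i j f. i \<noteq> j \<Longrightarrow> (x i - x j) * f = 0 \<Longrightarrow> f = 0"
  shows "finite S \<Longrightarrow> card S = Suc n \<Longrightarrow> j \<le> n \<Longrightarrow>
    first_column x S (\<lambda>p. x p ^ j) = (if j = n then vandermonde x S else 0)"
proof (induction n arbitrary: S j)
  case 0
  then obtain a where "S = {a}" by (auto simp: card_1_singleton_iff)
  moreover have "pairs {a} = {}" by (auto simp: pairs_def)
  ultimately show ?case using 0 by (simp add: first_column_singleton vandermonde_def)
next
  case (Suc n)
  define a z where "a = Min S" and "z = Max S"
  have ne: "S \<noteq> {}" using Suc.prems(2) by auto
  have z: "z \<in> S" "\<And>i. i \<in> S \<Longrightarrow> i \<le> z" and a: "a \<in> S" "\<And>i. i \<in> S \<Longrightarrow> a \<le> i"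
    using Suc.prems(1) ne by (auto simp: a_def z_def)
  have card: "card (S - {z}) = Suc n" "card (S - {a}) = Suc n"
    using Suc.prems z(1) a(1) by simp_all
  have fin: "finite (S - {z})" "finite (S - {a})" using Suc.prems(1) by auto
  note IHz = Suc.IH[OF fin(1) card(1)] and IHa = Suc.IH[OF fin(2) card(2)]
  have "a \<noteq> z"
  proof
    assume "a = z"
    then have "S = {a}" using a z by (metis antisym is_singletonI' is_singleton_the_elem ne singletonD)
    then show False using Suc.prems(2) by simp
  qed
  define P Q where "P = (\<Prod>i\<in>S - {z}. x i - x z)" and "Q = (\<Prod>i\<in>S - {a}. x a - x i)"
  \<comment> \<open>A constant column is written as the difference of two columns, each vanishing at
    one of the extreme indices.\<close>
  have "(x a - x z) * first_column x S (\<lambda>p. 1) = first_column x S (\<lambda>p. (x p - x z) * 1) - first_column x S (\<lambda>p. (x p - x a) * 1)"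
    unfolding first_column_diff[symmetric] first_column_mult[symmetric] by (rule arg_cong[of _ _ "first_column x S"]) auto
  also have "\<dots> = P * first_column x (S - {z}) (\<lambda>p. 1) - Q * first_column x (S - {a}) (\<lambda>p. 1)"
    unfolding P_def Q_def using first_column_Max[OF Suc.prems(1) z] first_column_Min[OF Suc.prems(1) a] by (simp only:)
  \<comment> \<open>With two elements, both products are \<open>x a - x z\<close> and both
    expansions are 1; with more, both expansions vanish by induction.\<close>
  also have "\<dots> = 0"
  proof (cases "n = 0")
    case True
    with Suc.prems(2) have "card S = 2" by simp
    then obtain c d where cd: "S = {c, d}" "c \<noteq> d" by (auto simp: card_2_iff)
    with a(1) z(1) \<open>a \<noteq> z\<close> have S: "S - {z} = {a}" "S - {a} = {z}" by auto
    show ?thesis by (simp add: P_def Q_def S first_column_singleton)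
  next
    case False
    then show ?thesis using IHz[of 0] IHa[of 0] by simp
  qed
  finally have zero: "first_column x S (\<lambda>p. 1) = 0" using cancel[OF \<open>a \<noteq> z\<close>] by blast
  from Suc.prems(3) show ?case
  proof (induction j)
    case 0
    then show ?case using zero by simp
  next
    case (Suc j)
    \<comment> \<open>Raising the power by one costs \<open>x z\<close> times the old column plus a
      column vanishing at \<open>z\<close>; in the top degree only the latter survives.\<close>
    have "first_column x S (\<lambda>p. x p ^ Suc j) - x z * first_column x S (\<lambda>p. x p ^ j)
        = first_column x S (\<lambda>p. (x p - x z) * x p ^ j)"
      unfolding first_column_diff[symmetric] first_column_mult[symmetric]
      by (rule arg_cong[of _ _ "first_column x S"]) (auto simp: algebra_simps)
    also have "\<dots> = P * first_column x (S - {z}) (\<lambda>p. x p ^ j)"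
      unfolding P_def by (rule first_column_Max) (use Suc.prems z \<open>finite S\<close> in auto)
    finally have *: "first_column x S (\<lambda>p. x p ^ Suc j)
        = x z * first_column x S (\<lambda>p. x p ^ j) + P * first_column x (S - {z}) (\<lambda>p. x p ^ j)"
      by (simp add: algebra_simps)
    have "vandermonde x S = P * vandermonde x (S - {z})"
      unfolding P_def by (rule vandermonde_Max) (use z \<open>finite S\<close> in auto)
    then show ?case
      unfolding * using Suc.IH Suc.prems IHz[of j] by auto
  qed
qed

end

section \<open>Expansion of the constant term along one variable\<close>

text \<open>Characteristic 0 and the absence of zero divisors serve to cancel the factor 2 in
  \<open>constant_term_antisymmetric\<close>.\<close>

locale uv_weights =
  fixes u v :: "'a::{idom,ring_char_0}"
begin

abbreviation x :: "nat \<Rightarrow> 'a mfls" where "x \<equiv> mvar"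
abbreviation y :: "nat \<Rightarrow> 'a mfls" where "y i \<equiv> inverse (mvar i)"

definition L :: "nat \<Rightarrow> 'a mfls" where "L i = 1 + mconst u * x i"
definition R :: "nat \<Rightarrow> 'a mfls" where "R i = 1 + (1 - mconst v) * x i"
definition w :: "nat \<Rightarrow> nat \<Rightarrow> 'a mfls" where
  "w i j = 1 + (1 - mconst v) * x i + mconst u * (x j + x i * x j)"
definition g :: "nat set \<Rightarrow> 'a mfls" where
  "g S = (\<Prod>(i, j)\<in>pairs S. (x i - x j) * w i j)"

lemma rename_xy: "bij \<pi> \<Longrightarrow> rename \<pi> (x i) = x (\<pi> i)" "bij \<pi> \<Longrightarrow> rename \<pi> (y i) = y (\<pi> i)"
  by (simp_all add: rename_mvar rename_inverse mvar_mult_inverse)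

lemma rename_LRw:
  assumes "bij \<pi>"
  shows "rename \<pi> (L i) = L (\<pi> i)" "rename \<pi> (R i) = R (\<pi> i)" "rename \<pi> (w i j) = w (\<pi> i) (\<pi> j)"
    "rename \<pi> (inverse (L i)) = inverse (L (\<pi> i))"
proof -
  note [simp] = rename_add rename_diff rename_mult rename_1 rename_mconst rename_xy assms
  show *: "rename \<pi> (L i) = L (\<pi> i)" "rename \<pi> (R i) = R (\<pi> i)" "rename \<pi> (w i j) = w (\<pi> i) (\<pi> j)"
    by (simp_all add: L_def R_def w_def)
  have "L i * inverse (L i) = 1" unfolding L_def by (rule one_plus_mult_inverse)
  from rename_inverse[OF assms this] show "rename \<pi> (inverse (L i)) = inverse (L (\<pi> i))"
    by (simp add: *)
qed

lemma w_eq: "w j i = L i * R j + mconst (u * v) * x i * x j"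
  by (simp add: L_def R_def w_def mconst_mult algebra_simps)

lemma rename_g: 
  assumes "bij \<pi>" "strict_mono_on S \<pi>"
  shows "rename \<pi> (g S) = g (\<pi> ` S)"
  unfolding g_def prod_pairs_image[OF assms(2)]
  by (simp add: rename_prod rename_mult rename_diff rename_xy rename_LRw assms(1) case_prod_unfold)

lemma w_at_0:
  shows "i \<noteq> p \<Longrightarrow> eq_at_0 p (w i p) (R i)" "i \<noteq> p \<Longrightarrow> eq_at_0 p (w p i) (L i)"
proof -
  note [intro] = regular_at_intros
  have "eq_at_0 p (R i + mconst u * (1 + x i) * x p) (R i + mconst u * (1 + x i) * 0)" if "i \<noteq> p"
    unfolding R_def by (intro eq_at_0_add eq_at_0_mult eq_at_0_mvar eq_at_0_refl) auto
  moreover have "eq_at_0 p (L i + (1 - mconst v + mconst u * x i) * x p) (L i + (1 - mconst v + mconst u * x i) * 0)" if "i \<noteq> p"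
    unfolding L_def by (intro eq_at_0_add eq_at_0_mult eq_at_0_mvar eq_at_0_refl) auto
  moreover have "R i + mconst u * (1 + x i) * x p = w i p" "L i + (1 - mconst v + mconst u * x i) * x p = w p i"
    by (simp_all add: L_def R_def w_def algebra_simps)
  ultimately show "i \<noteq> p \<Longrightarrow> eq_at_0 p (w i p) (R i)" "i \<noteq> p \<Longrightarrow> eq_at_0 p (w p i) (L i)"
    by simp_all
qed

section \<open>Removing one variable from the constant term\<close>

lemma mvar_power_mult_inverse_power: "x p ^ n * y p ^ n = 1"
  by (simp add: mvar_mult_inverse flip: power_mult_distrib)

text \<open>The first argument of \<open>\<Phi>\<close> selects a factor, the second the variable in
  which it is written. Removing a variable shifts the former and renames the latter.\<close>

definition F :: "nat \<Rightarrow> (nat \<Rightarrow> nat \<Rightarrow> 'a mfls) \<Rightarrow> 'a" where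
  "F n \<Phi> = constant_term ((\<Prod>i=1..n. \<Phi> i i * y i ^ (n - 1)) * g {1..n})"

text \<open>
  Only the values on \<open>{1..n}\<close> matter, where \<open>skip n p\<close> is the increasing enumeration of
  \<open>{1..Suc n} - {p}\<close>; the others make it a bijection.
\<close>

definition skip :: "nat \<Rightarrow> nat \<Rightarrow> nat \<Rightarrow> nat" where
  "skip n p i = (if i < p \<or> Suc n < i then i else if i = Suc n then p else Suc i)"

lemma skip:
  assumes "1 \<le> p" "p \<le> Suc n"
  shows "bij (skip n p)" "strict_mono_on {1..n} (skip n p)" "skip n p ` {1..n} = {1..Suc n} - {p}"
proof -
  define t where "t j = (if j < p \<or> Suc n < j then j else if j = p then Suc n else j - 1)" for j
  have ts: "t (skip n p i) = i" "skip n p (t i) = i" for i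
    using assms by (auto simp: t_def skip_def)
  show "bij (skip n p)" by (rule o_bij[of t]) (auto simp: ts)
  show "strict_mono_on {1..n} (skip n p)" by (auto simp: strict_mono_on_def skip_def)
  have "j \<in> skip n p ` {1..n}" if "j \<in> {1..Suc n} - {p}" for j
    using that assms by (intro image_eqI[of _ _ "t j"]) (auto simp: ts, auto simp: t_def)
  moreover have "skip n p ` {1..n} \<subseteq> {1..Suc n} - {p}" using assms by (auto simp: skip_def)
  ultimately show "skip n p ` {1..n} = {1..Suc n} - {p}" by blast
qed

text \<open>Factors before \<open>p\<close> receive the lower-end operation with its sign; those
  after \<open>p\<close> receive the upper-end operation and move down by one place, hence
  \<open>Suc i\<close>.\<close>

definition drop_var :: "nat \<Rightarrow> (nat \<Rightarrow> nat \<Rightarrow> 'a mfls) \<Rightarrow> nat \<Rightarrow> nat \<Rightarrow> 'a mfls" where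
  "drop_var p \<Phi> i j = (if i < p then - (R j * y j * \<Phi> i j) else L j * y j * \<Phi> (Suc i) j)"

text \<open>The power of \<open>x p\<close> from the Vandermonde expansion cancels the pole at
  \<open>p\<close>, after which the variable can be set to 0 and \<open>skip n p\<close> closes the
  gap in the numbering.\<close>

lemma F_expand_term:
  assumes p: "1 \<le> p" "p \<le> Suc n"
    and ren: "\<And>\<pi> i j. bij \<pi> \<Longrightarrow> rename \<pi> (\<Phi> i j) = \<Phi> i (\<pi> j)"
    and reg: "\<And>i j q. \<Phi> i j \<in> regular_at q"
    and zero: "eq_at_0 p (\<Phi> p p) (mconst z)"
  shows "constant_term ((\<Prod>i=1..Suc n. \<Phi> i i * y i ^ n) *
      ((- 1) ^ card {i\<in>{1..Suc n}. i < p} * x p ^ n *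
        vandermonde x ({1..Suc n} - {p}) * (\<Prod>(i, j)\<in>pairs {1..Suc n}. w i j)))
     = z * F n (drop_var p \<Phi>)"
proof -
  define S where "S = {1..Suc n}"
  have pS: "finite S" "p \<in> S" using p by (auto simp: S_def)
  \<comment> \<open>The Laplace sign has one factor -1 for each index below \<open>p\<close>; it is
    distributed over the factors \<open>R\<close>.\<close>
  define c where "c i = (if i < p then - R i else L i)" for i
  \<comment> \<open>\<open>A\<close> collects the factors left unchanged by the substitution at
    \<open>p\<close>.\<close>
  define A where "A = (\<Prod>i\<in>S - {p}. \<Phi> i i * y i ^ n) * vandermonde x (S - {p}) * (- 1) ^ (p - 1)"
  have A: "A \<in> regular_at p"
    unfolding A_def vandermonde_def case_prod_unfold by (intro regular_at_intros reg) auto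
  have w_reg: "w i j \<in> regular_at p" for i j unfolding w_def by (intro regular_at_intros)
  have card: "card {i\<in>S. i < p} = p - 1"
  proof -
    have "{i\<in>S. i < p} = {1..p - 1}" using p by (auto simp: S_def)
    then show ?thesis by simp
  qed
  have "(\<Prod>i\<in>S. \<Phi> i i * y i ^ n) * ((- 1) ^ card {i\<in>S. i < p} * x p ^ n *
        vandermonde x (S - {p}) * (\<Prod>(i, j)\<in>pairs S. w i j))
     = (x p ^ n * y p ^ n) * (A * (\<Phi> p p * (\<Prod>(i, j)\<in>pairs S. w i j)))"
    unfolding prod.remove[OF pS] A_def card by (simp only: mult_ac)
  also have "\<dots> = A * (\<Phi> p p * ((\<Prod>i\<in>{i\<in>S. i < p}. w i p) * (\<Prod>i\<in>{i\<in>S. p < i}. w p i) * (\<Prod>(i, j)\<in>pairs (S - {p}). w i j)))"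
    by (simp add: mvar_power_mult_inverse_power prod_pairs_remove[OF pS])
  \<comment> \<open>The pole is gone, so all factors are regular at \<open>p\<close> and may be
    replaced by their values at 0.\<close>
  also have "constant_term \<dots> = constant_term (A * (mconst z * ((\<Prod>i\<in>{i\<in>S. i < p}. R i) * (\<Prod>i\<in>{i\<in>S. p < i}. L i) * (\<Prod>(i, j)\<in>pairs (S - {p}). w i j))))"
    by (rule constant_term_eq_at_0[of p], intro eq_at_0_mult eq_at_0_prod zero w_at_0 eq_at_0_refl A)
       (auto simp: case_prod_unfold w_reg)
  also have "\<dots> = z * constant_term (A * ((\<Prod>i\<in>{i\<in>S. i < p}. R i) * (\<Prod>i\<in>{i\<in>S. p < i}. L i) * (\<Prod>(i, j)\<in>pairs (S - {p}). w i j)))"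
    by (subst constant_term_mconst_mult[symmetric]) (simp only: mult_ac)
  also have "A * ((\<Prod>i\<in>{i\<in>S. i < p}. R i) * (\<Prod>i\<in>{i\<in>S. p < i}. L i) * (\<Prod>(i, j)\<in>pairs (S - {p}). w i j))
     = (\<Prod>i\<in>S - {p}. \<Phi> i i * y i ^ n) * ((\<Prod>i\<in>{i\<in>S. i < p}. R i) * (\<Prod>i\<in>{i\<in>S. p < i}. L i) * (- 1) ^ (p - 1))
        * (vandermonde x (S - {p}) * (\<Prod>(i, j)\<in>pairs (S - {p}). w i j))"
    unfolding A_def by (simp only: mult_ac)
  also have "(\<Prod>i\<in>{i\<in>S. i < p}. R i) * (\<Prod>i\<in>{i\<in>S. p < i}. L i) * (- 1) ^ (p - 1) = (\<Prod>i\<in>S - {p}. c i)"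
  proof -
    have "S - {p} = {i\<in>S. i < p} \<union> {i\<in>S. p < i}" by auto
    then have "(\<Prod>i\<in>S - {p}. c i) = (\<Prod>i\<in>{i\<in>S. i < p}. c i) * (\<Prod>i\<in>{i\<in>S. p < i}. c i)"
      using pS(1) by (simp add: prod.union_disjoint disjoint_iff)
    also have "(\<Prod>i\<in>{i\<in>S. i < p}. c i) = (\<Prod>i\<in>{i\<in>S. i < p}. (- 1) * R i)"
      by (rule prod.cong) (auto simp: c_def)
    also have "\<dots> = (- 1) ^ (p - 1) * (\<Prod>i\<in>{i\<in>S. i < p}. R i)"
      by (simp only: prod.distrib prod_constant card)
    also have "(\<Prod>i\<in>{i\<in>S. p < i}. c i) = (\<Prod>i\<in>{i\<in>S. p < i}. L i)"
      by (rule prod.cong) (auto simp: c_def)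
    finally show ?thesis by (simp only: mult_ac)
  qed
  also have "vandermonde x (S - {p}) * (\<Prod>(i, j)\<in>pairs (S - {p}). w i j) = g (S - {p})"
    unfolding g_def vandermonde_def by (simp add: case_prod_unfold prod.distrib)
  also have "(\<Prod>i\<in>S - {p}. \<Phi> i i * y i ^ n) * (\<Prod>i\<in>S - {p}. c i) = (\<Prod>i\<in>S - {p}. c i * \<Phi> i i * y i ^ n)"
    unfolding prod.distrib[symmetric] by (simp only: mult_ac)
  also have "(\<Prod>i\<in>S - {p}. c i * \<Phi> i i * y i ^ n) * g (S - {p})
    = rename (skip n p) ((\<Prod>i=1..n. drop_var p \<Phi> i i * y i ^ (n - 1)) * g {1..n})"
  proof -
    note sk = skip[OF p]
    have "(\<Prod>i\<in>S - {p}. c i * \<Phi> i i * y i ^ n) = (\<Prod>i=1..n. c (skip n p i) * \<Phi> (skip n p i) (skip n p i) * y (skip n p i) ^ n)"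
      unfolding S_def sk(3)[symmetric] by (subst prod.reindex) (use sk(2) strict_mono_on_imp_inj_on in auto)
    also have "\<dots> = (\<Prod>i=1..n. rename (skip n p) (drop_var p \<Phi> i i * y i ^ (n - 1)))"
    proof (rule prod.cong[OF refl])
      fix i assume i: "i \<in> {1..n}"
      then have n: "n = Suc (n - 1)" by simp
      \<comment> \<open>One of the \<open>n\<close> inverse variables goes into
        \<open>drop_var\<close>; the other \<open>n - 1\<close> are those in
        \<open>F n\<close>.\<close>
      have yn: "y (skip n p i) ^ n = y (skip n p i) * y (skip n p i) ^ (n - 1)"
        by (subst n) (simp only: power_Suc)
      show "c (skip n p i) * \<Phi> (skip n p i) (skip n p i) * y (skip n p i) ^ n = rename (skip n p) (drop_var p \<Phi> i i * y i ^ (n - 1))"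
        unfolding yn using i p
        by (auto simp: rename_mult rename_uminus rename_power rename_xy rename_LRw ren sk(1) drop_var_def c_def)
           (auto simp: skip_def)
    qed
    finally have "(\<Prod>i\<in>S - {p}. c i * \<Phi> i i * y i ^ n) = rename (skip n p) (\<Prod>i=1..n. drop_var p \<Phi> i i * y i ^ (n - 1))"
      unfolding rename_prod[OF sk(1)] .
    moreover have "g (S - {p}) = rename (skip n p) (g {1..n})"
      unfolding rename_g[OF sk(1,2)] sk(3) S_def ..
    ultimately show ?thesis by (simp only: rename_mult[OF sk(1)])
  qed
  finally show ?thesis
    unfolding S_def[symmetric] F_def by (simp add: constant_term_rename skip[OF p])
qed

lemma F_expand:
  assumes "\<And>\<pi> i j. bij \<pi> \<Longrightarrow> rename \<pi> (\<Phi> i j) = \<Phi> i (\<pi> j)"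
    and "\<And>i j q. \<Phi> i j \<in> regular_at q"
    and "\<And>p. 1 \<le> p \<Longrightarrow> p \<le> Suc n \<Longrightarrow> eq_at_0 p (\<Phi> p p) (mconst (z p))"
  shows "F (Suc n) \<Phi> = (\<Sum>p=1..Suc n. z p * F n (drop_var p \<Phi>))"
proof -
  let ?S = "{1..Suc n}"
  have "g ?S = vandermonde x ?S * (\<Prod>(i, j)\<in>pairs ?S. w i j)"
    unfolding g_def vandermonde_def by (simp add: case_prod_unfold prod.distrib)
  also have "vandermonde x ?S = first_column x ?S (\<lambda>p. x p ^ n)"
    using first_column_power[of x ?S n n, OF mvar_diff_cancel] by simp
  finally have "F (Suc n) \<Phi> = constant_term (\<Sum>p\<in>?S. (\<Prod>i=1..Suc n. \<Phi> i i * y i ^ n) *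
      ((- 1) ^ card {i\<in>?S. i < p} * x p ^ n * vandermonde x (?S - {p}) * (\<Prod>(i, j)\<in>pairs ?S. w i j)))"
    unfolding F_def first_column_def by (simp only: sum_distrib_left sum_distrib_right diff_Suc_1)
  also have "\<dots> = (\<Sum>p\<in>?S. z p * F n (drop_var p \<Phi>))"
    unfolding constant_term_sum
    by (rule sum.cong[OF refl]) (rule F_expand_term; use assms in auto)
  finally show ?thesis .
qed

end

section \<open>Summation over strict rows\<close>

definition adjacent_swap :: "nat \<Rightarrow> nat \<Rightarrow> nat" where
  "adjacent_swap a i = (if i = a then Suc a else if i = Suc a then a else i)"

lemma adjacent_swap_involution: "adjacent_swap a (adjacent_swap a i) = i"
  by (simp add: adjacent_swap_def)

lemma bij_adjacent_swap: "bij (adjacent_swap a)"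
  by (rule o_bij[of "adjacent_swap a"]) (auto simp: adjacent_swap_involution)

lemma adjacent_swap_simps [simp]:
  "adjacent_swap a a = Suc a" "adjacent_swap a (Suc a) = a" "i \<noteq> a \<Longrightarrow> i \<noteq> Suc a \<Longrightarrow> adjacent_swap a i = i"
  by (simp_all add: adjacent_swap_def)

context uv_weights
begin

lemma constant_term_antisymmetric:
  fixes f :: "'a mfls"
  assumes "bij \<pi>" "rename \<pi> f = - f"
  shows "constant_term f = 0"
proof -
  have "- constant_term f = constant_term f"
    using constant_term_rename[OF assms(1), of f] by (simp only: assms(2) constant_term_uminus)
  then have "2 * constant_term f = 0"
    unfolding mult_2 by (metis add.right_inverse)
  then show ?thesis by simp
qed

text \<open>Swapping consecutive indices preserves the order in every pair except
  \<open>(a, Suc a)\<close>, so it only permutes the remaining factors.\<close>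

lemma g_adjacent_swap:
  assumes "finite S" "a \<in> S" "Suc a \<in> S"
  obtains g' where "g S = (x a - x (Suc a)) * w a (Suc a) * g'" "rename (adjacent_swap a) g' = g'"
proof
  let ?\<sigma> = "adjacent_swap a" and ?P = "pairs S - {(a, Suc a)}"
  let ?f = "\<lambda>(i, j). (x i - x j) * w i j"
  have "(a, Suc a) \<in> pairs S" using assms by (simp add: pairs_def)
  then show "g S = (x a - x (Suc a)) * w a (Suc a) * prod ?f ?P"
    unfolding g_def by (subst prod.remove[of _ "(a, Suc a)"]) (simp_all add: finite_pairs assms(1))
  have inS: "?\<sigma> i \<in> S \<longleftrightarrow> i \<in> S" for i using assms by (auto simp: adjacent_swap_def)
  have mem: "map_prod ?\<sigma> ?\<sigma> q \<in> ?P" if "q \<in> ?P" for q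
  proof -
    obtain i j where q: "q = (i, j)" by force
    with that have "i \<in> S" "j \<in> S" "i < j" "i \<noteq> a \<or> j \<noteq> Suc a" by (auto simp: pairs_def)
    moreover from this have "?\<sigma> i < ?\<sigma> j" "?\<sigma> i \<noteq> a \<or> ?\<sigma> j \<noteq> Suc a"
      unfolding adjacent_swap_def by (smt (verit) Suc_lessI less_Suc_eq not_less_eq)+
    ultimately show ?thesis by (simp add: q pairs_def inS)
  qed
  have inv: "map_prod ?\<sigma> ?\<sigma> (map_prod ?\<sigma> ?\<sigma> q) = q" for q
    by (cases q) (simp add: adjacent_swap_involution)
  have "rename ?\<sigma> (prod ?f ?P) = (\<Prod>q\<in>?P. ?f (map_prod ?\<sigma> ?\<sigma> q))"
    by (simp add: rename_prod bij_adjacent_swap rename_mult rename_diff rename_xy rename_LRw case_prod_unfold)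
  also have "\<dots> = prod ?f ?P"
    by (rule prod.reindex_bij_witness[where i = "map_prod ?\<sigma> ?\<sigma>" and j = "map_prod ?\<sigma> ?\<sigma>"])
       (simp_all only: inv mem)
  finally show "rename ?\<sigma> (prod ?f ?P) = prod ?f ?P" .
qed

text \<open>The extra \<open>w (Suc a) a\<close> makes the factor \<open>w a (Suc a)\<close> of
  \<open>g\<close> symmetric; only \<open>x a - x (Suc a)\<close> then changes sign.\<close>

lemma constant_term_swap_0:
  assumes "1 \<le> a" "Suc a \<le> N" "rename (adjacent_swap a) q = q"
  shows "constant_term (q * w (Suc a) a * ((\<Prod>i=1..N. y i ^ r) * g {1..N})) = 0"
proof (rule constant_term_antisymmetric[OF bij_adjacent_swap[of a]])
  let ?\<sigma> = "adjacent_swap a"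
  obtain g' where g': "g {1..N} = (x a - x (Suc a)) * w a (Suc a) * g'" "rename ?\<sigma> g' = g'"
    by (rule g_adjacent_swap[of "{1..N}" a]) (use assms in auto)
  have "rename ?\<sigma> (\<Prod>i=1..N. y i ^ r) = (\<Prod>i=1..N. y (?\<sigma> i) ^ r)"
    by (simp add: rename_prod rename_power rename_xy bij_adjacent_swap)
  also have "\<dots> = (\<Prod>i=1..N. y i ^ r)"
    by (rule prod.reindex_bij_witness[where i = ?\<sigma> and j = ?\<sigma>])
       (use assms in \<open>auto simp: adjacent_swap_involution adjacent_swap_def\<close>)
  finally have yy: "rename ?\<sigma> (\<Prod>i=1..N. y i ^ r) = (\<Prod>i=1..N. y i ^ r)" .
  show "rename ?\<sigma> (q * w (Suc a) a * ((\<Prod>i=1..N. y i ^ r) * g {1..N}))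
    = - (q * w (Suc a) a * ((\<Prod>i=1..N. y i ^ r) * g {1..N}))"
    unfolding g'(1)
    by (simp add: rename_mult rename_diff rename_xy rename_LRw bij_adjacent_swap yy[simplified] g'(2) assms(3) algebra_simps)
qed

end

text \<open>
  The sum over strict rows of length \<open>r\<close>, with \<open>t i + d i\<close> the free sum over the \<open>i\<close>-th entry and
  \<open>e i\<close> the correction for equal entries at \<open>i - 1\<close> and \<open>i\<close>; entries cannot be equal at two consecutive places.
\<close>

fun strict_sum :: "(nat \<Rightarrow> 'b::comm_ring_1) \<Rightarrow> (nat \<Rightarrow> 'b) \<Rightarrow> (nat \<Rightarrow> 'b) \<Rightarrow> nat \<Rightarrow> 'b" where
  "strict_sum t d e 0 = 1"
| "strict_sum t d e (Suc 0) = t 1 + d 1"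
| "strict_sum t d e (Suc (Suc r)) = strict_sum t d e (Suc r) * (t (Suc (Suc r)) + d (Suc (Suc r))) + e (Suc (Suc r)) * strict_sum t d e r"

text \<open>\<open>t\<close> and \<open>d\<close> stand for upper and lower ends. By
  \<open>td\<close>, an upper end followed by a lower end, corrected by \<open>e\<close>, acquires
  the factor \<open>w (Suc a) a\<close> with an invariant cofactor; \<open>kill\<close> removes such
  products.\<close>

context
  fixes t d e c :: "nat \<Rightarrow> 'a::comm_ring_1 mfls" and w :: "nat \<Rightarrow> nat \<Rightarrow> 'a mfls" and H :: "'a mfls" and K :: nat
  assumes kill: "\<And>a q. 1 \<le> a \<Longrightarrow> Suc a \<le> K \<Longrightarrow> rename (adjacent_swap a) q = q \<Longrightarrow> constant_term (q * w (Suc a) a * H) = 0"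
    and td: "\<And>a. 1 \<le> a \<Longrightarrow> Suc a \<le> K \<Longrightarrow> t a * d (Suc a) + e (Suc a) = c a * w (Suc a) a"
    and c_inv: "\<And>a. 1 \<le> a \<Longrightarrow> Suc a \<le> K \<Longrightarrow> rename (adjacent_swap a) (c a) = c a"
    and td_inv: "\<And>a i. i < a \<or> Suc a < i \<Longrightarrow> i \<le> K \<Longrightarrow> rename (adjacent_swap a) (t i) = t i"
      "\<And>a i. i < a \<or> Suc a < i \<Longrightarrow> i \<le> K \<Longrightarrow> rename (adjacent_swap a) (d i) = d i"
    and e_inv: "\<And>a i. 2 \<le> i \<Longrightarrow> i < a \<Longrightarrow> i \<le> K \<Longrightarrow> rename (adjacent_swap a) (e i) = e i"
begin

lemma rename_strict_sum: "r < a \<Longrightarrow> r \<le> K \<Longrightarrow> rename (adjacent_swap a) (strict_sum t d e r) = strict_sum t d e r"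
  by (induction r rule: induct_nat_012)
     (simp_all add: rename_1 rename_add rename_mult bij_adjacent_swap td_inv e_inv)

text \<open>If the last entry does not contribute its upper end, neither can any earlier one: lower
  ends propagate to the left, collected in \<open>q\<close>.\<close>

lemma constant_term_strict_sum_last:
  "Suc r \<le> K \<Longrightarrow> (\<And>a. 1 \<le> a \<Longrightarrow> a \<le> r \<Longrightarrow> rename (adjacent_swap a) q = q) \<Longrightarrow>
    constant_term ((strict_sum t d e (Suc r) - strict_sum t d e r * t (Suc r)) * q * H) = constant_term ((\<Prod>i=1..Suc r. d i) * q * H)"
proof (induction r arbitrary: q)
  case (Suc r)
  let ?Z = "strict_sum t d e"
  let ?q = "d (Suc (Suc r)) * q"
  have tdr: "t (Suc r) * d (Suc (Suc r)) + e (Suc (Suc r)) = c (Suc r) * w (Suc (Suc r)) (Suc r)"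
    using td[of "Suc r"] Suc.prems(1) by simp
  \<comment> \<open>Splitting off from \<open>?Z (Suc r)\<close> the part with an upper end at
    \<open>Suc r\<close> brings that end next to the correction \<open>e\<close>.\<close>
  have "(?Z (Suc (Suc r)) - ?Z (Suc r) * t (Suc (Suc r))) * q * H
      = (?Z (Suc r) - ?Z r * t (Suc r)) * ?q * H
        + ?Z r * (t (Suc r) * d (Suc (Suc r)) + e (Suc (Suc r))) * q * H"
    by (simp add: algebra_simps)
  also have "?Z r * (t (Suc r) * d (Suc (Suc r)) + e (Suc (Suc r))) * q * H
      = (?Z r * c (Suc r) * q) * w (Suc (Suc r)) (Suc r) * H"
    unfolding tdr by (simp only: mult_ac)
  also have "constant_term ((?Z (Suc r) - ?Z r * t (Suc r)) * ?q * H + (?Z r * c (Suc r) * q) * w (Suc (Suc r)) (Suc r) * H)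
      = constant_term ((?Z (Suc r) - ?Z r * t (Suc r)) * ?q * H)"
    using kill[of "Suc r" "?Z r * c (Suc r) * q"] Suc.prems
    by (simp add: constant_term_add rename_mult bij_adjacent_swap rename_strict_sum c_inv)
  also have "\<dots> = constant_term ((\<Prod>i=1..Suc r. d i) * ?q * H)"
    by (rule Suc.IH) (use Suc.prems in \<open>auto simp: rename_mult bij_adjacent_swap td_inv\<close>)
  finally show ?case by (simp add: mult_ac)
qed simp

text \<open>Either the last entry contributes its upper end, which is absorbed into
  \<open>q\<close>, or all entries contribute lower ends; \<open>p\<close> is the place of the
  switch, and \<open>p = Suc r\<close> means only lower ends.\<close>

lemma constant_term_strict_sum:
  "r \<le> K \<Longrightarrow> (\<And>a. 1 \<le> a \<Longrightarrow> a < r \<Longrightarrow> rename (adjacent_swap a) q = q) \<Longrightarrow>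
    constant_term (strict_sum t d e r * q * H) = (\<Sum>p=1..Suc r. constant_term ((\<Prod>i=1..r. if i < p then d i else t i) * q * H))"
proof (induction r arbitrary: q)
  case (Suc r)
  let ?Z = "strict_sum t d e"
  have "?Z (Suc r) * q * H = ?Z r * (t (Suc r) * q) * H + (?Z (Suc r) - ?Z r * t (Suc r)) * q * H"
    by (simp add: algebra_simps)
  then have "constant_term (?Z (Suc r) * q * H)
      = constant_term (?Z r * (t (Suc r) * q) * H) + constant_term ((\<Prod>i=1..Suc r. d i) * q * H)"
    using constant_term_strict_sum_last[of r q] Suc.prems by (simp only: constant_term_add)
  also have "constant_term (?Z r * (t (Suc r) * q) * H)
      = (\<Sum>p=1..Suc r. constant_term ((\<Prod>i=1..r. if i < p then d i else t i) * (t (Suc r) * q) * H))"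
    by (rule Suc.IH) (use Suc.prems in \<open>auto simp: rename_mult bij_adjacent_swap td_inv\<close>)
  also have "\<dots> = (\<Sum>p=1..Suc r. constant_term ((\<Prod>i=1..Suc r. if i < p then d i else t i) * q * H))"
    by (rule sum.cong[OF refl]) (simp add: mult_ac del: sum.cl_ivl_Suc)
  also have "(\<Prod>i=1..Suc r. d i) = (\<Prod>i=1..Suc r. if i < Suc (Suc r) then d i else t i)"
    by (rule prod.cong) auto
  finally show ?case by (simp only: sum.cl_ivl_Suc) simp
qed simp

end

section \<open>Gog trapezoids by rows\<close>

definition rows :: "(nat \<Rightarrow> nat) \<Rightarrow> (nat \<Rightarrow> nat) \<Rightarrow> nat \<Rightarrow> (nat \<Rightarrow> nat) set" where
  "rows lo hi r = {c. (\<forall>j. j \<notin> {1..r} \<longrightarrow> c j = 0) \<and> (\<forall>j\<in>{1..r}. lo j \<le> c j \<and> c j \<le> hi j) \<and>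
    (\<forall>j\<in>{1..<r}. c j < c (Suc j))}"

lemma finite_rows: "finite (rows lo hi r)"
proof (rule finite_subset)
  let ?B = "\<Union>j\<in>{1..r}. {..hi j}"
  show "rows lo hi r \<subseteq> {c. \<forall>j. (j \<in> {1..r} \<longrightarrow> c j \<in> ?B) \<and> (j \<notin> {1..r} \<longrightarrow> c j = 0)}"
    unfolding rows_def by blast
  show "finite {c. \<forall>j. (j \<in> {1..r} \<longrightarrow> c j \<in> ?B) \<and> (j \<notin> {1..r} \<longrightarrow> c j = 0)}"
    by (rule finite_set_of_finite_funs) auto
qed

lemma rows_0: "rows lo hi 0 = {\<lambda>_. 0}"
  by (auto simp: rows_def)

lemma rows_Suc_iff:
  "c \<in> rows lo hi (Suc r) \<longleftrightarrow> c(Suc r := 0) \<in> rows lo hi r \<and> lo (Suc r) \<le> c (Suc r) \<and> c (Suc r) \<le> hi (Suc r) \<and>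
    (r \<noteq> 0 \<longrightarrow> c r < c (Suc r))"
proof
  assume c: "c \<in> rows lo hi (Suc r)"
  then have "c j < c (Suc j)" if "1 \<le> j" "j \<le> r" for j using that by (auto simp: rows_def)
  with c show "c(Suc r := 0) \<in> rows lo hi r \<and> lo (Suc r) \<le> c (Suc r) \<and> c (Suc r) \<le> hi (Suc r) \<and>
    (r \<noteq> 0 \<longrightarrow> c r < c (Suc r))"
    by (auto simp: rows_def)
next
  assume c: "c(Suc r := 0) \<in> rows lo hi r \<and> lo (Suc r) \<le> c (Suc r) \<and> c (Suc r) \<le> hi (Suc r) \<and>
    (r \<noteq> 0 \<longrightarrow> c r < c (Suc r))"
  have z: "c j = 0" if "j \<notin> {1..Suc r}" for j
    using c that unfolding rows_def by (auto dest: spec[of _ j])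
  have b: "lo j \<le> c j \<and> c j \<le> hi j" if "j \<in> {1..Suc r}" for j
    using c that unfolding rows_def by (cases "j = Suc r") (auto dest: bspec[of _ _ j])
  have s: "c j < c (Suc j)" if "j \<in> {1..<Suc r}" for j
    using c that unfolding rows_def by (cases "j = r") (auto dest: bspec[of _ _ j])
  show "c \<in> rows lo hi (Suc r)" using z b s unfolding rows_def by blast
qed

lemma sum_rows_Suc:
  fixes f :: "(nat \<Rightarrow> nat) \<Rightarrow> 'a::comm_monoid_add"
  shows "(\<Sum>c\<in>rows lo hi (Suc r). f c) =
    (\<Sum>(c, a) \<in> {(c, a). c \<in> rows lo hi r \<and> a \<in> {lo (Suc r)..hi (Suc r)} \<and> (r \<noteq> 0 \<longrightarrow> c r < a)}. f (c(Suc r := a)))"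
proof (rule sum.reindex_bij_witness[where j = "\<lambda>c. (c(Suc r := 0), c (Suc r))" and i = "\<lambda>(c, a). c(Suc r := a)"], goal_cases)
  case (4 p)
  then obtain c a where p: "p = (c, a)" "c \<in> rows lo hi r" "a \<in> {lo (Suc r)..hi (Suc r)}" "r \<noteq> 0 \<longrightarrow> c r < a" by auto
  then have "c(Suc r := 0) = c" by (auto simp: rows_def fun_eq_iff)
  with p show ?case by (simp add: rows_Suc_iff)
next
  case (3 p)
  then show ?case by (auto simp: rows_def fun_eq_iff)
qed (auto simp: rows_Suc_iff)

text \<open>Adjacent ranges share only the endpoint \<open>hi i = lo (Suc i)\<close>, so strictness
  can fail only by equality there; these cases are subtracted through \<open>e\<close>.\<close>

lemma sum_rows_eq_strict_sum:
  fixes T :: "nat \<Rightarrow> nat \<Rightarrow> 'a::comm_ring_1"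
  assumes "\<And>i. 1 \<le> i \<Longrightarrow> i \<le> K \<Longrightarrow> lo i < hi i"
    and "\<And>i. 1 \<le> i \<Longrightarrow> i < K \<Longrightarrow> hi i = lo (Suc i)"
    and "\<And>i. 1 \<le> i \<Longrightarrow> i \<le> K \<Longrightarrow> (\<Sum>a=lo i..hi i. T i a) = t i + d i"
    and "\<And>i. 1 \<le> i \<Longrightarrow> i < K \<Longrightarrow> e (Suc i) = - (T i (hi i) * T (Suc i) (lo (Suc i)))"
  shows "r \<le> K \<Longrightarrow> (\<Sum>c\<in>rows lo hi r. \<Prod>j=1..r. T j (c j)) = strict_sum t d e r"
proof (induction r rule: induct_nat_012)
  case 0
  then show ?case by (simp add: rows_0)
next
  case 1
  have "{(c, a). c \<in> rows lo hi 0 \<and> a \<in> {lo (Suc 0)..hi (Suc 0)} \<and> (0 \<noteq> (0::nat) \<longrightarrow> c 0 < a)}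
      = Pair (\<lambda>_. 0) ` {lo (Suc 0)..hi (Suc 0)}"
    by (auto simp: rows_0)
  then have "(\<Sum>c\<in>rows lo hi (Suc 0). \<Prod>j=1..Suc 0. T j (c j)) = (\<Sum>a=lo 1..hi 1. T 1 a)"
    unfolding sum_rows_Suc by (simp only:) (simp add: sum.reindex inj_on_def)
  with assms(3)[of 1] 1 show ?case by simp
next
  case (ge2 r)
  let ?P = "\<lambda>r c. \<Prod>j=1..r. T j (c j)" and ?s = "Suc (Suc r)"
  have hi: "hi (Suc r) = lo ?s" "lo (Suc r) < lo ?s" "lo ?s < hi ?s"
    using assms(1)[of "Suc r"] assms(1)[of ?s] assms(2)[of "Suc r"] ge2.prems by auto
  define B where "B = rows lo hi (Suc r) \<times> {lo ?s..hi ?s}"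
  define good where "good = {(c, a). c \<in> rows lo hi (Suc r) \<and> a \<in> {lo ?s..hi ?s} \<and> (Suc r \<noteq> 0 \<longrightarrow> c (Suc r) < a)}"
  define bad where "bad = {(c, a). c \<in> rows lo hi (Suc r) \<and> a = lo ?s \<and> c (Suc r) = lo ?s}"
  have fin: "finite B" by (simp add: B_def finite_rows)
  have "c (Suc r) \<le> lo ?s" if "c \<in> rows lo hi (Suc r)" for c
    using that hi(1) by (simp add: rows_Suc_iff)
  then have B: "B = good \<union> bad" "good \<inter> bad = {}"
    using hi(3) by (force simp: B_def good_def bad_def)+
  have "strict_sum t d e (Suc r) * (t ?s + d ?s) = (\<Sum>(c, a)\<in>B. ?P (Suc r) c * T ?s a)"
  proof -
    have "strict_sum t d e (Suc r) = (\<Sum>c\<in>rows lo hi (Suc r). ?P (Suc r) c)" "t ?s + d ?s = (\<Sum>a=lo ?s..hi ?s. T ?s a)"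
      using ge2 assms(3)[of ?s] by simp_all
    then show ?thesis
      by (simp only: B_def sum_product sum.cartesian_product)
  qed
  also have "\<dots> = (\<Sum>(c, a)\<in>good. ?P (Suc r) c * T ?s a) + (\<Sum>(c, a)\<in>bad. ?P (Suc r) c * T ?s a)"
    using fin B by (metis (no_types, lifting) finite_Un sum.union_disjoint)
  also have "(\<Sum>(c, a)\<in>good. ?P (Suc r) c * T ?s a) = (\<Sum>c\<in>rows lo hi ?s. ?P ?s c)"
    unfolding sum_rows_Suc[of _ _ _ "Suc r"] good_def[symmetric]
  proof (rule sum.cong[OF refl], clarify)
    fix c :: "nat \<Rightarrow> nat" and a
    have "(\<Prod>j=1..Suc r. T j ((c(?s := a)) j)) = ?P (Suc r) c" by (rule prod.cong) auto
    moreover have "?P ?s (c(?s := a)) = (\<Prod>j=1..Suc r. T j ((c(?s := a)) j)) * T ?s ((c(?s := a)) ?s)"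
      by (subst prod.cl_ivl_Suc) simp
    ultimately show "?P (Suc r) c * T ?s a = ?P ?s (c(?s := a))" by simp
  qed
  also have "(\<Sum>(c, a)\<in>bad. ?P (Suc r) c * T ?s a) = (\<Sum>c\<in>rows lo hi r. ?P r c * T (Suc r) (hi (Suc r)) * T ?s (lo ?s))"
  proof (rule sum.reindex_bij_witness[where j = "\<lambda>(c, a). c(Suc r := 0)" and i = "\<lambda>c. (c(Suc r := lo ?s), lo ?s)"], goal_cases)
    case (3 c)
    then have "c (Suc r) = 0" by (simp add: rows_def)
    then show ?case by auto
  next
    case (4 c)
    then have z: "c(Suc r := 0) = c" by (auto simp: rows_def)
    \<comment> \<open>Once entry \<open>Suc r\<close> is fixed at its upper bound, strictness before
      it is automatic, so the shortened row is arbitrary.\<close>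
    have "c r < lo ?s" if "r \<noteq> 0"
    proof -
      have "c r \<le> hi r" using 4 that by (simp add: rows_def)
      also have "hi r = lo (Suc r)" using assms(2)[of r] that ge2.prems by simp
      finally show ?thesis using hi(2) by simp
    qed
    then show ?case using 4 hi by (simp add: bad_def rows_Suc_iff z)
  next
    case (5 p)
    then obtain c where p: "p = (c, lo ?s)" "c (Suc r) = lo ?s" by (auto simp: bad_def)
    have "(\<Prod>j=1..r. T j ((c(Suc r := 0)) j)) = ?P r c" by (rule prod.cong) auto
    then show ?case by (simp add: p hi(1) mult_ac)
  qed (auto simp: bad_def rows_Suc_iff)
  also have "\<dots> = - e ?s * strict_sum t d e r"
  proof -
    have "strict_sum t d e r = (\<Sum>c\<in>rows lo hi r. ?P r c)" "e ?s = - (T (Suc r) (hi (Suc r)) * T ?s (lo ?s))"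
      using ge2 assms(4)[of "Suc r"] by simp_all
    then show ?thesis by (simp only: minus_minus sum_distrib_left mult_ac)
  qed
  finally show ?case by (simp add: algebra_simps)
qed

section \<open>Removing the bottom row of a trapezoid\<close>

lemma gog_trapezoid_iff:
  "gog_trapezoid m n k G \<longleftrightarrow>
    (\<forall>i j. \<not> (1 \<le> j \<and> j \<le> i \<and> i \<le> n \<and> j \<le> k) \<longrightarrow> G i j = 0) \<and>
    (\<forall>i j. 1 \<le> j \<and> j \<le> i \<and> i \<le> n \<and> j \<le> k \<longrightarrow> 0 < G i j \<and> G i j \<le> m + n - i + j) \<and>
    (\<forall>i j. 1 \<le> j \<and> j \<le> i \<and> Suc i \<le> n \<and> j \<le> k \<longrightarrow> G (Suc i) j \<le> G i j) \<and>
    (\<forall>i j. 1 \<le> j \<and> j \<le> i \<and> Suc i \<le> n \<and> Suc j \<le> k \<longrightarrow> G i j \<le> G (Suc i) (Suc j)) \<and>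
    (\<forall>i j. 1 \<le> j \<and> Suc j \<le> i \<and> i \<le> n \<and> Suc j \<le> k \<longrightarrow> G i j < G i (Suc j))"
proof -
  have idx: "(i, j) \<in> gog_index n k \<longleftrightarrow> 1 \<le> j \<and> j \<le> i \<and> i \<le> n \<and> j \<le> k" for i j
    by (auto simp: gog_index_def)
  show ?thesis
    unfolding gog_trapezoid_def Ball_def split_paired_All prod.case idx
    by (auto simp: Suc_le_eq)
qed

text \<open>
  The last entry of a row with no entry to its lower right is bounded only by the trapezoid condition
  \<open>m\<^sub>i\<^sub>j \<le> m + n - i + j\<close> for the row above the bottom row.
\<close>

definition row_max :: "nat \<Rightarrow> nat \<Rightarrow> (nat \<Rightarrow> nat) \<Rightarrow> nat \<Rightarrow> nat" where
  "row_max m k b i = (if i < k then b (Suc i) else m + k + 1)"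

text \<open>\<open>b\<close> is arbitrary off \<open>{1..k}\<close>, whereas arrays vanish off their
  index set.\<close>

definition bottom :: "nat \<Rightarrow> (nat \<Rightarrow> nat) \<Rightarrow> nat \<Rightarrow> nat" where
  "bottom k b j = (if j \<in> {1..k} then b j else 0)"

text \<open>The share of an entry \<open>a\<close> at place \<open>j\<close> in the equalities with
  the bottom row. The entry at \<open>k\<close> has no lower right neighbour, hence the test
  \<open>j < k\<close>.\<close>

definition row_weight :: "nat \<Rightarrow> (nat \<Rightarrow> nat) \<Rightarrow> 'a::comm_ring_1 \<Rightarrow> 'a \<Rightarrow> nat \<Rightarrow> nat \<Rightarrow> 'a" where
  "row_weight k b u v j a = (if j < k \<and> a = b (Suc j) then u else 1) * (if a = b j then v else 1)"

context
  fixes m N k K :: nat and b :: "nat \<Rightarrow> nat"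
  assumes k: "k \<le> Suc N" and K: "K = min k N"
    and b_pos: "\<forall>i\<in>{1..k}. 0 < b i" and b_mono: "strict_mono_on {1..k} b"
    and b_le: "0 < k \<longrightarrow> b k \<le> m + k"
begin

lemma b_less: "1 \<le> j \<Longrightarrow> Suc j \<le> k \<Longrightarrow> b j < b (Suc j)"
  using strict_mono_onD[OF b_mono, of j "Suc j"] by auto

text \<open>Strictness carries the bound on the last entry to the left; this is the trapezoid
  condition in the bottom row.\<close>

lemma b_bound: "j \<in> {1..k} \<Longrightarrow> b j \<le> m + j"
proof -
  assume "j \<in> {1..k}"
  then have "j \<le> k" "1 \<le> j" by auto
  then show ?thesis
  proof (induction rule: inc_induct)
    case base
    then show ?case using b_le by simp
  next
    case (step i)
    then show ?case using b_less[of i] by simp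
  qed
qed

text \<open>\<open>m\<close> becomes \<open>m + 1\<close> because the bound
  \<open>m + Suc N - i + j\<close> must stay the same with one row fewer.\<close>

lemma gog_top_row:
  assumes "G \<in> gog_trapezoids_with_bottom m (Suc N) k b"
  shows "G N \<in> rows b (row_max m k b) K" "G(Suc N := (\<lambda>_. 0)) \<in> gog_trapezoids_with_bottom (m + 1) N K (G N)"
    "G (Suc N) = bottom k b"
proof -
  have G: "gog_trapezoid m (Suc N) k G" "\<And>j. j \<in> {1..k} \<Longrightarrow> G (Suc N) j = b j"
    using assms by (auto simp: gog_trapezoids_with_bottom_def)
  note G' = G(1)[unfolded gog_trapezoid_iff]
  show "G (Suc N) = bottom k b"
    using G' G(2) k by (auto simp: bottom_def fun_eq_iff)
  have zero: "G N j = 0" if "j \<notin> {1..K}" for j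
    using G' that K by auto
  have lo: "b j \<le> G N j" if "j \<in> {1..K}" for j
  proof -
    have "G (Suc N) j \<le> G N j" using G' that K by auto
    with G(2)[of j] that K show ?thesis by simp
  qed
  have hi: "G N j \<le> row_max m k b j" if "j \<in> {1..K}" for j
  proof (cases "j < k")
    case True
    then have "G N j \<le> G (Suc N) (Suc j)" using G' that K by auto
    with G(2)[of "Suc j"] True show ?thesis by (simp add: row_max_def)
  next
    case False
    then have "j = k" "G N j \<le> m + Suc N - N + j"
      using conjunct1[OF conjunct2[OF G'], rule_format, of j N] that K by auto
    then show ?thesis by (simp add: row_max_def)
  qed
  have mono: "G N j < G N (Suc j)" if "j \<in> {1..<K}" for j
    using G' that K by auto
  show "G N \<in> rows b (row_max m k b) K"
    using zero lo hi mono by (auto simp: rows_def)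
  have "gog_trapezoid (m + 1) N K (G(Suc N := (\<lambda>_. 0)))"
    unfolding gog_trapezoid_iff using G' K by (auto simp: fun_upd_def)
  then show "G(Suc N := (\<lambda>_. 0)) \<in> gog_trapezoids_with_bottom (m + 1) N K (G N)"
    by (simp add: gog_trapezoids_with_bottom_def)
qed

text \<open>Converse to \<open>gog_top_row\<close>: the conditions between the last two rows are the
  bounds in \<open>rows\<close>, and those within the bottom row come from the hypotheses on
  \<open>b\<close>.\<close>

lemma gog_extend:
  assumes c: "c \<in> rows b (row_max m k b) K" and G: "G \<in> gog_trapezoids_with_bottom (m + 1) N K c"
  shows "G(Suc N := bottom k b) \<in> gog_trapezoids_with_bottom m (Suc N) k b" "G N = c" "G(Suc N := (\<lambda>_. 0)) = G"
proof -
  have G': "gog_trapezoid (m + 1) N K G" "\<And>j. j \<in> {1..K} \<Longrightarrow> G N j = c j"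
    using G by (auto simp: gog_trapezoids_with_bottom_def)
  note G'' = G'(1)[unfolded gog_trapezoid_iff]
  show "G(Suc N := (\<lambda>_. 0)) = G"
    using G'' by (auto simp: fun_eq_iff)
  show GN: "G N = c"
  proof
    fix j show "G N j = c j"
    proof (cases "j \<in> {1..K}")
      case False
      then have "c j = 0" using c unfolding rows_def by blast
      moreover have "G N j = 0" using G'' False K by auto
      ultimately show ?thesis by simp
    qed (rule G'(2))
  qed
  have c_lo: "b j \<le> G N j" and c_hi: "G N j \<le> row_max m k b j" if "1 \<le> j" "j \<le> K" for j
    using c that by (simp_all add: rows_def GN)
  define H where "H = G(Suc N := bottom k b)"
  have H: "H (Suc N) = bottom k b" "i \<noteq> Suc N \<Longrightarrow> H i = G i" for i by (simp_all add: H_def)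
  have zero: "G i j = 0" if "\<not> (1 \<le> j \<and> j \<le> i \<and> i \<le> N \<and> j \<le> K)" for i j
    using G'' that by blast
  have pos: "0 < G i j" "G i j \<le> m + 1 + N - i + j" if "1 \<le> j" "j \<le> i" "i \<le> N" "j \<le> K" for i j
    using G'' that by blast+
  have down: "G (Suc i) j \<le> G i j" if "1 \<le> j" "j \<le> i" "Suc i \<le> N" "j \<le> K" for i j
    using G'' that by blast
  have diag: "G i j \<le> G (Suc i) (Suc j)" if "1 \<le> j" "j \<le> i" "Suc i \<le> N" "Suc j \<le> K" for i j
    using G'' that by blast
  have row: "G i j < G i (Suc j)" if "1 \<le> j" "Suc j \<le> i" "i \<le> N" "Suc j \<le> K" for i j
    using G'' that by blast
  have "gog_trapezoid m (Suc N) k H"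
    unfolding gog_trapezoid_iff
  proof (intro conjI allI impI)
    fix i j
    { assume a: "\<not> (1 \<le> j \<and> j \<le> i \<and> i \<le> Suc N \<and> j \<le> k)"
      show "H i j = 0"
      proof (cases "i = Suc N")
        case True
        with a k show ?thesis by (auto simp: H bottom_def)
      next
        case False
        with a K show ?thesis unfolding H(2)[OF False] by (intro zero) auto
      qed }
    { assume a: "1 \<le> j \<and> j \<le> i \<and> i \<le> Suc N \<and> j \<le> k"
      have "0 < H i j \<and> H i j \<le> m + Suc N - i + j"
      proof (cases "i = Suc N")
        case True
        with a b_pos b_bound[of j] show ?thesis by (simp add: H bottom_def)
      next
        case False
        with a K pos[of j i] show ?thesis unfolding H(2)[OF False] by simp
      qed
      then show "0 < H i j" "H i j \<le> m + Suc N - i + j" by simp_all }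
    { assume a: "1 \<le> j \<and> j \<le> i \<and> Suc i \<le> Suc N \<and> j \<le> k"
      show "H (Suc i) j \<le> H i j"
      proof (cases "i = N")
        case True
        with a K c_lo[of j] show ?thesis by (simp add: H bottom_def)
      next
        case False
        with a K down[of j i] show ?thesis by (simp add: H)
      qed }
    { assume a: "1 \<le> j \<and> j \<le> i \<and> Suc i \<le> Suc N \<and> Suc j \<le> k"
      show "H i j \<le> H (Suc i) (Suc j)"
      proof (cases "i = N")
        case True
        with a K c_hi[of j] show ?thesis by (simp add: H bottom_def row_max_def)
      next
        case False
        with a K diag[of j i] show ?thesis by (simp add: H)
      qed }
    { assume a: "1 \<le> j \<and> Suc j \<le> i \<and> i \<le> Suc N \<and> Suc j \<le> k"
      show "H i j < H i (Suc j)"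
      proof (cases "i = Suc N")
        case True
        with a b_less[of j] show ?thesis by (simp add: H bottom_def)
      next
        case False
        with a K row[of j i] show ?thesis unfolding H(2)[OF False] by simp
      qed }
  qed
  then show "G(Suc N := bottom k b) \<in> gog_trapezoids_with_bottom m (Suc N) k b"
    by (simp add: gog_trapezoids_with_bottom_def bottom_def H_def)
qed

text \<open>Pairs with \<open>i = N\<close> compare the last two rows; all others lie in the smaller
  index set.\<close>

lemma gog_inv_Suc:
  assumes G: "G \<in> gog_trapezoids_with_bottom m (Suc N) k b"
  shows "gog_inv (Suc N) k G = gog_inv N K (G(Suc N := (\<lambda>_. 0))) + card {j\<in>{1..K}. j < k \<and> G N j = b (Suc j)}"
    "gog_inv' (Suc N) k G = gog_inv' N K (G(Suc N := (\<lambda>_. 0))) + card {j\<in>{1..K}. G N j = b j}"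
proof -
  let ?H = "G(Suc N := (\<lambda>_. 0))"
  have bot: "j \<in> {1..k} \<Longrightarrow> G (Suc N) j = b j" for j
    using gog_top_row(3)[OF G] by (simp add: bottom_def)
  have fin: "finite (gog_index N K)"
    by (rule finite_subset[of _ "{..N} \<times> {..N}"]) (auto simp: gog_index_def)
  define A where "A = {(i, j). (i, j) \<in> gog_index N K \<and> (i + 1, j + 1) \<in> gog_index N K \<and> ?H i j = ?H (i + 1) (j + 1)}"
  define B where "B = {j\<in>{1..K}. j < k \<and> G N j = b (Suc j)}"
  have A: "finite A" by (rule finite_subset[OF _ fin]) (auto simp: A_def)
  have "{(i, j). (i, j) \<in> gog_index (Suc N) k \<and> (i + 1, j + 1) \<in> gog_index (Suc N) k \<and> G i j = G (i + 1) (j + 1)}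
    = A \<union> Pair N ` B" (is "?L = _")
  proof (rule set_eqI, clarify)
    fix i j
    show "(i, j) \<in> ?L \<longleftrightarrow> (i, j) \<in> A \<union> Pair N ` B"
      using K bot[of "Suc j"] by (cases "i = N") (auto simp: A_def B_def gog_index_def)
  qed
  moreover have "A \<inter> Pair N ` B = {}" by (auto simp: A_def gog_index_def)
  moreover have "card (Pair N ` B) = card B" by (rule card_image) (simp add: inj_on_def)
  ultimately show "gog_inv (Suc N) k G = gog_inv N K ?H + card {j\<in>{1..K}. j < k \<and> G N j = b (Suc j)}"
    unfolding gog_inv_def A_def[symmetric] B_def[symmetric] using A by (simp add: card_Un_disjoint B_def)
  define A where "A = {(i, j). (i, j) \<in> gog_index N K \<and> (i + 1, j) \<in> gog_index N K \<and> ?H i j = ?H (i + 1) j}"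
  define B where "B = {j\<in>{1..K}. G N j = b j}"
  have A: "finite A" by (rule finite_subset[OF _ fin]) (auto simp: A_def)
  have "{(i, j). (i, j) \<in> gog_index (Suc N) k \<and> (i + 1, j) \<in> gog_index (Suc N) k \<and> G i j = G (i + 1) j}
    = A \<union> Pair N ` B" (is "?L = _")
  proof (rule set_eqI, clarify)
    fix i j
    show "(i, j) \<in> ?L \<longleftrightarrow> (i, j) \<in> A \<union> Pair N ` B"
      using K bot[of j] by (cases "i = N") (auto simp: A_def B_def gog_index_def)
  qed
  moreover have "A \<inter> Pair N ` B = {}" by (auto simp: A_def gog_index_def)
  moreover have "card (Pair N ` B) = card B" by (rule card_image) (simp add: inj_on_def)
  ultimately show "gog_inv' (Suc N) k G = gog_inv' N K ?H + card {j\<in>{1..K}. G N j = b j}"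
    unfolding gog_inv'_def A_def[symmetric] B_def[symmetric] using A by (simp add: card_Un_disjoint B_def)
qed

lemma prod_row_weight:
  "(\<Prod>j=1..K. row_weight k b u v j (c j)) = u ^ card {j\<in>{1..K}. j < k \<and> c j = b (Suc j)} * v ^ card {j\<in>{1..K}. c j = b j}"
proof -
  have "(\<Prod>j\<in>S. if P j then z else 1) = z ^ card {j\<in>S. P j}" if "finite S" for S :: "nat set" and P and z :: 'a
    using that by (simp add: prod.If_cases Int_def)
  then show ?thesis unfolding row_weight_def prod.distrib by simp
qed

lemma gog_sum_Suc:
  "(\<Sum>G\<in>gog_trapezoids_with_bottom m (Suc N) k b. u ^ gog_inv (Suc N) k G * v ^ gog_inv' (Suc N) k G)
   = (\<Sum>c\<in>rows b (row_max m k b) K. (\<Prod>j=1..K. row_weight k b u v j (c j)) *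
       (\<Sum>G\<in>gog_trapezoids_with_bottom (m + 1) N K c. u ^ gog_inv N K G * v ^ gog_inv' N K G))"
proof -
  have "(\<Sum>G\<in>gog_trapezoids_with_bottom m (Suc N) k b. u ^ gog_inv (Suc N) k G * v ^ gog_inv' (Suc N) k G)
    = (\<Sum>(c, G)\<in>Sigma (rows b (row_max m k b) K) (gog_trapezoids_with_bottom (m + 1) N K).
        (\<Prod>j=1..K. row_weight k b u v j (c j)) * (u ^ gog_inv N K G * v ^ gog_inv' N K G))"
  proof (rule sum.reindex_bij_witness[where j = "\<lambda>G. (G N, G(Suc N := (\<lambda>_. 0)))" and i = "\<lambda>(c, G). G(Suc N := bottom k b)"], goal_cases)
    case (1 G)
    then show ?case using gog_top_row(3)[OF 1] by auto
  next
    case (2 G)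
    then show ?case using gog_top_row[OF 2] by auto
  next
    case (3 p)
    then obtain c G where p: "p = (c, G)" "c \<in> rows b (row_max m k b) K" "G \<in> gog_trapezoids_with_bottom (m + 1) N K c"
      by auto
    show ?case by (simp add: p(1) gog_extend[OF p(2,3)])
  next
    case (4 p)
    then obtain c G where p: "p = (c, G)" "c \<in> rows b (row_max m k b) K" "G \<in> gog_trapezoids_with_bottom (m + 1) N K c"
      by auto
    show ?case using gog_extend(1)[OF p(2,3)] by (simp add: p(1))
  next
    case (5 G)
    show ?case by (simp only: prod.case gog_inv_Suc[OF 5] prod_row_weight power_add mult_ac)
  qed
  also have "\<dots> = (\<Sum>c\<in>rows b (row_max m k b) K. (\<Prod>j=1..K. row_weight k b u v j (c j)) *
       (\<Sum>G\<in>gog_trapezoids_with_bottom (m + 1) N K c. u ^ gog_inv N K G * v ^ gog_inv' N K G))"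
    unfolding sum_distrib_left by (rule sum.Sigma[symmetric]) (auto simp: finite_rows finite_gog_trapezoids_with_bottom)
  finally show ?thesis .
qed

end

section \<open>The constant term formula\<close>

text \<open>A geometric sum over the interior plus two weighted ends, which are distinct since
  \<open>lo < hi\<close>. Multiplying by \<open>x\<close> avoids division in a general ring.\<close>

lemma sum_power_weighted:
  fixes x \<alpha> \<beta> :: "'a::comm_ring_1"
  assumes "lo < hi"
  shows "x * (\<Sum>a=lo..hi. (if a = hi then \<alpha> else 1) * (if a = lo then \<beta> else 1) * (1 + x) ^ a)
    = (1 + \<alpha> * x) * (1 + x) ^ hi - (1 + (1 - \<beta>) * x) * (1 + x) ^ lo"
proof -
  obtain r where hi: "hi = Suc (lo + r)" using less_imp_Suc_add[OF assms] by blast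
  let ?f = "\<lambda>a. (if a = hi then \<alpha> else 1) * (if a = lo then \<beta> else 1) * (1 + x) ^ a"
  have "(\<Sum>a=lo..hi. ?f a) = (\<Sum>a=lo..lo + r. ?f a) + ?f hi"
    unfolding hi by (subst sum.cl_ivl_Suc) simp
  also have "(\<Sum>a=lo..lo + r. ?f a) = ?f lo + (\<Sum>a=Suc lo..lo + r. ?f a)"
    by (rule sum.atLeast_Suc_atMost) simp
  also have "(\<Sum>a=Suc lo..lo + r. ?f a) = (\<Sum>a=Suc lo..lo + r. (1 + x) ^ a)"
    by (rule sum.cong) (auto simp: hi)
  also have "?f lo = \<beta> * (1 + x) ^ lo" using assms by simp
  also have "?f hi = \<alpha> * (1 + x) ^ hi" using assms by simp
  finally have "x * (\<Sum>a=lo..hi. ?f a)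
      = x * (\<beta> * (1 + x) ^ lo) + x * (\<Sum>a=Suc lo..lo + r. (1 + x) ^ a) + x * (\<alpha> * (1 + x) ^ hi)"
    by (simp only: distrib_left)
  also have "x * (\<Sum>a=Suc lo..lo + r. (1 + x) ^ a) = (1 + x) ^ hi - (1 + x) * (1 + x) ^ lo"
  proof -
    have "x * (\<Sum>a=Suc lo..lo + s. (1 + x) ^ a) + (1 + x) * (1 + x) ^ lo = (1 + x) ^ Suc (lo + s)" for s
    proof (induction s)
      case (Suc s)
      have "x * (\<Sum>a=Suc lo..lo + Suc s. (1 + x) ^ a) + (1 + x) * (1 + x) ^ lo
          = (x * (\<Sum>a=Suc lo..lo + s. (1 + x) ^ a) + (1 + x) * (1 + x) ^ lo) + x * (1 + x) ^ Suc (lo + s)"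
        by (simp del: power_Suc add: distrib_left)
      also have "\<dots> = (1 + x) ^ Suc (lo + Suc s)"
        unfolding Suc.IH by (simp add: distrib_right)
      finally show ?case .
    qed simp
    then show ?thesis unfolding hi by (simp only: eq_diff_eq)
  qed
  finally have eq: "x * (\<Sum>a=lo..hi. ?f a)
      = x * (\<beta> * (1 + x) ^ lo) + ((1 + x) ^ hi - (1 + x) * (1 + x) ^ lo) + x * (\<alpha> * (1 + x) ^ hi)" .
  define A B where "A = (1 + x) ^ lo" and "B = (1 + x) ^ hi"
  show ?thesis unfolding eq A_def[symmetric] B_def[symmetric] by (simp add: algebra_simps)
qed

lemma mfls_power_int_minus_int: "f powi (- int l) = inverse f ^ l" for f :: "'a::comm_ring_1 mfls"
proof (cases l)
  case (Suc l')
  then have "\<not> 0 \<le> - int l" "nat (- (- int l)) = l" by simp_all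
  then show ?thesis by (simp only: power_int_def if_False)
qed simp

lemma rows_strict_mono:
  assumes "c \<in> rows lo hi r"
  shows "strict_mono_on {1..r} c"
proof (rule strict_mono_onI)
  fix i j assume "i \<in> {1..r}" "j \<in> {1..r}" "i < j"
  then have "Suc i \<le> j" "j \<le> r" "1 \<le> i" by auto
  then show "c i < c j"
  proof (induction rule: dec_induct)
    case base
    then show ?case using assms by (simp add: rows_def)
  next
    case (step l)
    moreover from step have "c l < c (Suc l)" using assms by (simp add: rows_def)
    ultimately show ?case by simp
  qed
qed

section \<open>The recursion for the constant term and the induction on rows\<close>

context uv_weights
begin

lemma L_inverse: "L j * inverse (L j) = 1"
  unfolding L_def by (rule one_plus_mult_inverse)

text \<open>The factors of the formula with the common pole of order \<open>n - 1\<close> taken out: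
  for \<open>i > k\<close>, \<open>- n + i - k = - (n - 1) + (i - k - 1)\<close>.\<close>

definition \<phi> :: "(nat \<Rightarrow> nat) \<Rightarrow> nat \<Rightarrow> nat \<Rightarrow> nat \<Rightarrow> nat \<Rightarrow> 'a mfls" where
  "\<phi> b m k i j = (if i \<le> k then (1 + x j) ^ b i
    else (1 + x j) ^ (m + i + 1) * inverse (L j) ^ (i - k) * x j ^ (i - k - 1))"

lemma rename_\<phi>: "bij \<pi> \<Longrightarrow> rename \<pi> (\<phi> b m k i j) = \<phi> b m k i (\<pi> j)"
  by (simp add: \<phi>_def rename_mult rename_power rename_add rename_1 rename_xy rename_LRw)

lemma regular_at_\<phi>: "\<phi> b m k i j \<in> regular_at q"
proof -
  have "inverse (L j) \<in> regular_at q" unfolding L_def by (rule regular_at_inverse)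
  then show ?thesis
    unfolding \<phi>_def
    by (cases "i \<le> k")
       (simp_all only: if_True if_False regular_at_mult regular_at_power regular_at_add regular_at_1 regular_at_mvar)
qed

text \<open>A positive power of the variable is present exactly from \<open>p = k + 2\<close> on;
  all other factors have value 1 at 0.\<close>

lemma \<phi>_at_0: "eq_at_0 p (\<phi> b m k p p) (mconst (if p \<le> Suc k then 1 else 0))"
proof -
  have X: "eq_at_0 p (1 + x p) 1"
    using eq_at_0_add[OF eq_at_0_refl[OF regular_at_1] eq_at_0_mvar, of p] by simp
  have reg: "inverse (L p) \<in> regular_at p" unfolding L_def by (rule regular_at_inverse)
  have "inverse (L p) - 1 = inverse (L p) - L p * inverse (L p)" by (simp add: L_inverse)
  also have "\<dots> = x p * (- mconst u * inverse (L p))" by (simp add: L_def algebra_simps)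
  finally have L: "eq_at_0 p (inverse (L p)) 1"
    using reg unfolding eq_at_0_def
    by (intro conjI bexI[of _ "- mconst u * inverse (L p)"])
       (simp_all only: regular_at_1 regular_at_mult regular_at_uminus regular_at_mconst)
  have "eq_at_0 p ((1 + x p) ^ (m + p + 1) * inverse (L p) ^ (p - k) * x p ^ (p - k - 1))
      (1 ^ (m + p + 1) * 1 ^ (p - k) * 0 ^ (p - k - 1))"
    by (intro eq_at_0_mult eq_at_0_power X L eq_at_0_mvar)
  then show ?thesis
    using eq_at_0_power[OF X, of "b p"] by (auto simp: \<phi>_def mconst_0 mconst_1 power_0_left split: if_splits)
qed

text \<open>Both sides become a sum over the omitted index \<open>p \<le> Suc K\<close>, the right
  one by \<open>constant_term_strict_sum\<close>, the left one by \<open>F_expand\<close>, whose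
  further terms vanish.\<close>

lemma F_step:
  assumes k: "k \<le> Suc N" and K: "K = min k N"
    and b_mono: "strict_mono_on {1..k} b"
    and b_le: "0 < k \<longrightarrow> b k \<le> m + k"
  shows "F (Suc N) (\<phi> b m k)
    = (\<Sum>c\<in>rows b (row_max m k b) K. (\<Prod>j=1..K. row_weight k b u v j (c j)) * F N (\<phi> c (m + 1) K))"
proof -
  define hi where "hi = row_max m k b"
  define T where "T j a = mconst (row_weight k b u v j a) * (1 + x j) ^ a" for j a
  define t where "t i = L i * y i * \<phi> b m k (Suc i) i" for i
  define d where "d i = - (R i * y i * \<phi> b m k i i)" for i
  define e where "e i = - (T (i - 1) (hi (i - 1)) * T i (b i))" for i
  \<comment> \<open>The invariant cofactor of \<open>w (Suc a) a\<close>: both ends carry the same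
    exponent \<open>b (Suc a)\<close>.\<close>
  define c' where "c' a = - (y a * y (Suc a) * ((1 + x a) * (1 + x (Suc a))) ^ b (Suc a))" for a
  \<comment> \<open>The factors of \<open>\<phi> c (m + 1) K\<close> beyond \<open>K\<close>; being
    independent of \<open>c\<close>, they leave the sum over rows.\<close>
  define \<psi> where "\<psi> i = (1 + x i) ^ (m + 1 + i + 1) * inverse (L i) ^ (i - K) * x i ^ (i - K - 1)" for i
  define Q where "Q = (\<Prod>i=Suc K..N. \<psi> i)"
  define H where "H = (\<Prod>i=1..N. y i ^ (N - 1)) * g {1..N}"
  note bij = bij_adjacent_swap
  note ren = rename_mult rename_uminus rename_power rename_add rename_1 rename_xy rename_LRw rename_\<phi> rename_mconst rename_prod bij
  have b_less: "b i < b (Suc i)" if "1 \<le> i" "Suc i \<le> k" for i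
    using strict_mono_onD[OF b_mono, of i "Suc i"] that by auto
  have less: "b i < hi i" if "1 \<le> i" "i \<le> K" for i
    using that K b_less[of i] b_le by (cases "i < k") (auto simp: hi_def row_max_def)
  have hi: "hi i = b (Suc i)" if "i < k" for i
    using that by (simp add: hi_def row_max_def)
  have split: "(\<Prod>i=1..N. h i) = (\<Prod>i=1..K. h i) * (\<Prod>i=Suc K..N. h i)" for h :: "nat \<Rightarrow> 'a mfls"
    using prod.ub_add_nat[of 1 K h "N - K"] K by simp
  have sum_T: "(\<Sum>a=b i..hi i. T i a) = t i + d i" if i: "1 \<le> i" "i \<le> K" for i
  proof -
    \<comment> \<open>At \<open>i = k\<close> the upper end has no lower right neighbour and hence
      no weight \<open>u\<close>.\<close>
    define \<alpha> where "\<alpha> = (if i < k then mconst u else 1)"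
    have "T i a = (if a = hi i then \<alpha> else 1) * (if a = b i then mconst v else 1) * (1 + x i) ^ a" if "a \<in> {b i..hi i}" for a
      using hi[of i] by (auto simp: T_def row_weight_def \<alpha>_def mconst_mult mconst_1)
    then have "x i * (\<Sum>a=b i..hi i. T i a)
      = x i * (\<Sum>a=b i..hi i. (if a = hi i then \<alpha> else 1) * (if a = b i then mconst v else 1) * (1 + x i) ^ a)"
      by simp
    also have "\<dots> = (1 + \<alpha> * x i) * (1 + x i) ^ hi i - R i * (1 + x i) ^ b i"
      unfolding sum_power_weighted[OF less[OF i]] R_def ..
    also have "(1 + \<alpha> * x i) * (1 + x i) ^ hi i = L i * \<phi> b m k (Suc i) i"
    proof (cases "i < k")
      case True
      then show ?thesis by (simp add: \<alpha>_def L_def \<phi>_def hi)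
    next
      case False
      with i K have "i = k" by simp
      \<comment> \<open>The inverse of \<open>L\<close> in the first additional factor compensates
        for the missing \<open>u\<close>, and the extra factor \<open>1 + x i\<close> accounts for
        the exponent \<open>m + k + 2\<close>.\<close>
      then have "L i * \<phi> b m k (Suc i) i = (L i * inverse (L i)) * (1 + x i) ^ (m + k + 2)"
        by (simp add: \<phi>_def mult_ac)
      with \<open>i = k\<close> show ?thesis by (simp add: \<alpha>_def hi_def row_max_def L_inverse)
    qed
    also have "R i * (1 + x i) ^ b i = R i * \<phi> b m k i i" using i K by (simp add: \<phi>_def)
    finally have eq: "x i * (\<Sum>a=b i..hi i. T i a) = L i * \<phi> b m k (Suc i) i - R i * \<phi> b m k i i" .
    have "y i * (x i * (\<Sum>a=b i..hi i. T i a)) = t i + d i"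
      unfolding eq t_def d_def by (simp add: algebra_simps)
    moreover have "y i * (x i * (\<Sum>a=b i..hi i. T i a)) = x i * y i * (\<Sum>a=b i..hi i. T i a)" by (simp only: mult_ac)
    ultimately show ?thesis by (simp add: mvar_mult_inverse)
  qed
  have td: "t a * d (Suc a) + e (Suc a) = c' a * w (Suc a) a" if a: "1 \<le> a" "Suc a \<le> K" for a
  proof -
    have lt: "b a < b (Suc a)" "Suc a < k \<Longrightarrow> b (Suc a) < b (Suc (Suc a))" using a K b_less by auto
    have T: "T a (hi a) = mconst u * (1 + x a) ^ b (Suc a)" "T (Suc a) (b (Suc a)) = mconst v * (1 + x (Suc a)) ^ b (Suc a)"
      using a K hi[of a] lt by (auto simp: T_def row_weight_def)
    have \<phi>: "\<phi> b m k (Suc a) j = (1 + x j) ^ b (Suc a)" for j using a K by (simp add: \<phi>_def)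
    have one: "x a * y a = 1" "x (Suc a) * y (Suc a) = 1" by (rule mvar_mult_inverse)+
    \<comment> \<open>Inserting \<open>x * y = 1\<close> twice puts the correction over the same
      denominators as the product of the two ends.\<close>
    have "T a (hi a) * T (Suc a) (b (Suc a)) = (x a * y a) * (x (Suc a) * y (Suc a)) * (T a (hi a) * T (Suc a) (b (Suc a)))"
      by (simp only: one mult_1)
    then have e: "e (Suc a) = - ((x a * y a) * (x (Suc a) * y (Suc a)) * (mconst u * (1 + x a) ^ b (Suc a) * (mconst v * (1 + x (Suc a)) ^ b (Suc a))))"
      by (simp only: e_def diff_Suc_1 T)
    define P P' where "P = (1 + x a) ^ b (Suc a)" and "P' = (1 + x (Suc a)) ^ b (Suc a)"
    show ?thesis
      unfolding t_def d_def c'_def w_eq \<phi> e power_mult_distrib mconst_mult P_def[symmetric] P'_def[symmetric]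
      by (simp add: algebra_simps)
  qed
  have kill: "constant_term (q * w (Suc a) a * H) = 0"
    if "1 \<le> a" "Suc a \<le> K" "rename (adjacent_swap a) q = q" for a q
    unfolding H_def by (rule constant_term_swap_0) (use that K in auto)
  have c'_inv: "rename (adjacent_swap a) (c' a) = c' a" for a
    by (simp add: c'_def ren mult_ac)
  have td_inv: "rename (adjacent_swap a) (t i) = t i" "rename (adjacent_swap a) (d i) = d i"
    if "i < a \<or> Suc a < i" for a i
    using that by (auto simp: t_def d_def ren)
  have e_inv: "rename (adjacent_swap a) (e i) = e i" if "2 \<le> i" "i < a" for a i
    using that by (auto simp: e_def T_def ren)
  have Q_inv: "rename (adjacent_swap a) Q = Q" if "a < K" for a
    unfolding Q_def using that by (simp add: ren \<psi>_def)
  have Z: "(\<Sum>c\<in>rows b hi K. \<Prod>j=1..K. T j (c j)) = strict_sum t d e K"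
    by (rule sum_rows_eq_strict_sum[where K = K]) (use K in \<open>auto simp: less hi sum_T e_def\<close>)
  have "(\<Prod>j=1..K. row_weight k b u v j (c j)) * F N (\<phi> c (m + 1) K) = constant_term ((\<Prod>j=1..K. T j (c j)) * Q * H)" for c
  proof -
    have "(\<Prod>i=1..N. \<phi> c (m + 1) K i i) = (\<Prod>i=1..K. (1 + x i) ^ c i) * Q"
      unfolding split Q_def by (intro arg_cong2[of _ _ _ _ "(*)"] prod.cong) (auto simp: \<phi>_def \<psi>_def)
    then have "F N (\<phi> c (m + 1) K) = constant_term ((\<Prod>i=1..K. (1 + x i) ^ c i) * Q * H)"
      by (simp add: F_def prod.distrib H_def mult_ac)
    then show ?thesis
      by (simp add: constant_term_mconst_mult[symmetric] T_def prod.distrib mconst_prod mult_ac)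
  qed
  then have "(\<Sum>c\<in>rows b hi K. (\<Prod>j=1..K. row_weight k b u v j (c j)) * F N (\<phi> c (m + 1) K))
      = constant_term (strict_sum t d e K * Q * H)"
    unfolding Z[symmetric] by (simp add: constant_term_sum sum_distrib_right)
  also have "\<dots> = (\<Sum>p=1..Suc K. constant_term ((\<Prod>i=1..K. if i < p then d i else t i) * Q * H))"
    by (rule constant_term_strict_sum[where c = c' and w = w and K = K])
       (use kill td c'_inv td_inv e_inv Q_inv in auto)
  also have "\<dots> = (\<Sum>p=1..Suc K. F N (drop_var p (\<phi> b m k)))"
  proof (rule sum.cong[OF refl])
    fix p assume p: "p \<in> {1..Suc K}"
    have "(\<Prod>i=1..N. drop_var p (\<phi> b m k) i i) = (\<Prod>i=1..K. if i < p then d i else t i) * Q"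
      unfolding split Q_def
    proof (intro arg_cong2[of _ _ _ _ "(*)"] prod.cong refl)
      fix i assume "i \<in> {Suc K..N}"
      \<comment> \<open>A nonempty range beyond \<open>K\<close> excludes \<open>K = N\<close>.
        Since \<open>p \<le> Suc K \<le> i\<close>, the upper-end branch of \<open>drop_var\<close>
        applies and cancels one inverse of \<open>L\<close> and one \<open>x i\<close>.\<close>
      with K have i: "K = k" "k < i" by auto
      obtain r where r: "i = Suc (k + r)" using less_imp_Suc_add[OF i(2)] by blast
      have "drop_var p (\<phi> b m k) i i = L i * y i * ((1 + x i) ^ (m + Suc i + 1) * inverse (L i) ^ Suc (Suc r) * x i ^ Suc r)"
        using i p by (simp add: drop_var_def \<phi>_def r)
      also have "\<dots> = (L i * inverse (L i)) * (x i * y i) * ((1 + x i) ^ (m + Suc i + 1) * inverse (L i) ^ Suc r * x i ^ r)"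
        by (simp only: power_Suc mult_ac)
      also have "\<dots> = \<psi> i" using i by (simp add: L_inverse mvar_mult_inverse \<psi>_def r)
      finally show "drop_var p (\<phi> b m k) i i = \<psi> i" .
    qed (auto simp: drop_var_def t_def d_def)
    then show "constant_term ((\<Prod>i=1..K. if i < p then d i else t i) * Q * H) = F N (drop_var p (\<phi> b m k))"
      by (simp add: F_def prod.distrib H_def mult_ac)
  qed
  \<comment> \<open>For \<open>k \<le> N\<close> the added terms have coefficient 0; for
    \<open>k = Suc N\<close> the two ranges agree.\<close>
  also have "\<dots> = (\<Sum>p=1..Suc N. (if p \<le> Suc k then 1 else 0) * F N (drop_var p (\<phi> b m k)))"
    by (rule sum.mono_neutral_cong_left) (use K in auto)
  also have "\<dots> = F (Suc N) (\<phi> b m k)"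
    by (rule F_expand[symmetric]) (auto simp: rename_\<phi> regular_at_\<phi> \<phi>_at_0)
  finally show ?thesis unfolding hi_def ..
qed

lemma gog_sum_eq_F:
  assumes "k \<le> n" "\<forall>i\<in>{1..k}. 0 < b i" "strict_mono_on {1..k} b" "0 < k \<longrightarrow> b k \<le> m + k"
  shows "(\<Sum>G\<in>gog_trapezoids_with_bottom m n k b. u ^ gog_inv n k G * v ^ gog_inv' n k G) = F n (\<phi> b m k)"
  using assms
proof (induction n arbitrary: m k b)
  case 0
  have idx: "gog_index 0 k = {}" by (auto simp: gog_index_def)
  have "gog_trapezoid m 0 k G \<longleftrightarrow> G = (\<lambda>_ _. 0)" for G
    by (simp add: gog_trapezoid_def idx fun_eq_iff)
  then have "gog_trapezoids_with_bottom m 0 k b = {\<lambda>_ _. 0}"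
    using 0 by (simp add: gog_trapezoids_with_bottom_def)
  moreover have "pairs {} = {}" by (simp add: pairs_def)
  ultimately show ?case by (simp add: idx gog_inv_def gog_inv'_def F_def g_def constant_term_1)
next
  case (Suc N)
  define K where "K = min k N"
  have "(\<Sum>G\<in>gog_trapezoids_with_bottom (m + 1) N K c. u ^ gog_inv N K G * v ^ gog_inv' N K G) = F N (\<phi> c (m + 1) K)"
    if c: "c \<in> rows b (row_max m k b) K" for c
  proof (rule Suc.IH)
    show "K \<le> N" by (simp add: K_def)
    show "\<forall>i\<in>{1..K}. 0 < c i"
    proof
      fix i assume i: "i \<in> {1..K}"
      then have "b i \<le> c i" using c by (simp add: rows_def)
      moreover have "0 < b i" using Suc.prems(2) i by (simp add: K_def)
      ultimately show "0 < c i" by simp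
    qed
    show "strict_mono_on {1..K} c" using c by (rule rows_strict_mono)
    show "0 < K \<longrightarrow> c K \<le> m + 1 + K"
    proof
      assume "0 < K"
      then have "c K \<le> row_max m k b K" using c by (simp add: rows_def)
      \<comment> \<open>Either \<open>K = k\<close> and the bound is the trapezoid condition, or
        \<open>K = N\<close> and it is the last entry of \<open>b\<close>.\<close>
      also have "\<dots> \<le> m + 1 + K"
      proof (cases "k \<le> N")
        case True
        then show ?thesis by (simp add: row_max_def K_def)
      next
        case False
        then have "k = Suc N" using Suc.prems(1) by simp
        with Suc.prems(4) show ?thesis by (simp add: row_max_def K_def)
      qed
      finally show "c K \<le> m + 1 + K" .
    qed
  qed
  then show ?case
    unfolding F_step[OF Suc.prems(1) K_def Suc.prems(3,4)] gog_sum_Suc[OF Suc.prems(1) K_def Suc.prems(2-4)] by simp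
qed

end

theorem theorem3p2:
  fixes m n k :: nat and b :: "nat \<Rightarrow> nat"
  assumes "k \<le> n"
    and "\<forall>i \<in> {1..k}. 0 < b i"
    and "strict_mono_on {1..k} b"
    and "0 < k \<longrightarrow> b k \<le> m + k"
  defines "x \<equiv> (mvar :: nat \<Rightarrow> int poly poly mfls)"
    and "u \<equiv> mconst indet_u"
    and "v \<equiv> mconst indet_v"
  shows "(\<Sum>G \<in> gog_trapezoids_with_bottom m n k b. indet_u ^ gog_inv n k G * indet_v ^ gog_inv' n k G)
    = constant_term
       ((\<Prod>i = 1..k. (1 + x i) ^ b i * x i powi (- int n + 1)) *
        (\<Prod>i = k+1..n. (1 + x i) ^ (m + i + 1) * (1 + u * x i) powi (int k - int i) *
                        x i powi (- int n + int i - int k)) *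
        (\<Prod>(i, j) \<in> {(i, j). 1 \<le> i \<and> i < j \<and> j \<le> n}.
           (x i - x j) * (1 + (1 - v) * x i + u * (x j + x i * x j))))"
proof -
  interpret uv_weights indet_u indet_v .
  let ?y = "\<lambda>i. inverse (mvar i) :: int poly poly mfls"
  have first: "(\<Prod>i=1..k. (1 + x i) ^ b i * x i powi (- int n + 1)) = (\<Prod>i=1..k. \<phi> b m k i i * ?y i ^ (n - 1))"
  proof (rule prod.cong[OF refl])
    fix i assume i: "i \<in> {1..k}"
    with assms(1) have "- int n + 1 = - int (n - 1)" by simp
    then have "x i powi (- int n + 1) = ?y i ^ (n - 1)" by (simp only: mfls_power_int_minus_int x_def)
    with i show "(1 + x i) ^ b i * x i powi (- int n + 1) = \<phi> b m k i i * ?y i ^ (n - 1)"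
      by (simp add: \<phi>_def x_def)
  qed
  have second: "(\<Prod>i=k+1..n. (1 + x i) ^ (m + i + 1) * (1 + u * x i) powi (int k - int i) * x i powi (- int n + int i - int k))
     = (\<Prod>i=k+1..n. \<phi> b m k i i * ?y i ^ (n - 1))"
  proof (rule prod.cong[OF refl])
    fix i assume i: "i \<in> {k+1..n}"
    \<comment> \<open>\<open>r\<close> is the power of \<open>x i\<close> kept in
      \<open>\<phi>\<close> and \<open>l\<close> the order of the given pole, so that
      \<open>r + l = n - 1\<close>.\<close>
    define r where "r = i - k - 1"
    define l where "l = n - i + k"
    have eqs: "int k - int i = - int (Suc r)" "- int n + int i - int k = - int l" "i - k = Suc r" "n - 1 = r + l"
      using i by (auto simp: r_def l_def)
    have "x i powi (- int l) = ?y i ^ l" by (simp only: mfls_power_int_minus_int x_def)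
    also have "\<dots> = x i ^ r * ?y i ^ r * ?y i ^ l" by (simp add: x_def mvar_power_mult_inverse_power)
    finally have 1: "x i powi (- int l) = x i ^ r * ?y i ^ (r + l)" by (simp only: power_add mult_ac)
    have 2: "(1 + u * x i) powi (- int (Suc r)) = inverse (L i) ^ Suc r" by (simp only: mfls_power_int_minus_int L_def u_def x_def)
    have \<phi>: "\<phi> b m k i i = (1 + x i) ^ (m + i + 1) * inverse (L i) ^ Suc r * x i ^ r"
      using i by (simp add: \<phi>_def eqs(3) x_def)
    show "(1 + x i) ^ (m + i + 1) * (1 + u * x i) powi (int k - int i) * x i powi (- int n + int i - int k)
        = \<phi> b m k i i * ?y i ^ (n - 1)"
      unfolding eqs(1,2,4) 1 2 \<phi> by (simp only: mult_ac)
  qed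
  have "pairs {1..n} = {(i, j). 1 \<le> i \<and> i < j \<and> j \<le> n}" by (auto simp: pairs_def)
  then have third: "(\<Prod>(i, j) \<in> {(i, j). 1 \<le> i \<and> i < j \<and> j \<le> n}.
      (x i - x j) * (1 + (1 - v) * x i + u * (x j + x i * x j))) = g {1..n}"
    by (simp add: g_def w_def x_def u_def v_def)
  have eq: "(\<Prod>i=1..k. \<phi> b m k i i * ?y i ^ (n - 1)) * (\<Prod>i=k+1..n. \<phi> b m k i i * ?y i ^ (n - 1))
      = (\<Prod>i=1..n. \<phi> b m k i i * ?y i ^ (n - 1))"
    using prod.ub_add_nat[of 1 k "\<lambda>i. \<phi> b m k i i * ?y i ^ (n - 1)" "n - k"] assms(1) by simp
  show ?thesis
    unfolding first second third gog_sum_eq_F[OF assms(1-4)] F_def eq ..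
qed

end
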